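(* For every total function $f:\omega\to\omega$ which is approximable from above, there is a computable connected graph $G$ such that the Turing degree spectrum of its distance function $d$ is $\{\deg(f)\}$. Indeed, for every computable graph $H$ isomorphic to $G$, the distance function $d_H$ on $H$ satisfies $$d_H\equiv_1 d \leq_{2\text{-btt}} f \leq_{1\text{-btt}} d_H.$$
   Context: A (symmetric, irreflexive) graph is computable if its domain is $\omega$ or a finite initial segment of $\omega$ and its edge relation is computable. For a connected graph $G$, the distance function $d:G^2\to\omega$ gives the length of the shortest path between two nodes ($d(x,x)=0$); functions on $G^2$ are regarded as functions on $\omega$ via a fixed computable pairing bijection $\langle\cdot,\cdot\rangle:\omega^2\to\omega$. The Turing degree spectrum of the distance function on $G$ is the set of Turing degrees of the distance functions of all computable graphs isomorphic to $G$. A total $f:\omega\to\omega$ is approximable from above if $f(x)=\lim_s g(x,s)$ for some total computable $g$ with $g(x,s+1)\le g(x,s)$ for all $x,s$. For partial functions $\varphi,\psi$ on $\omega$: $\varphi\le_m\psi$ if $\varphi=\psi\circ h$ for some total computable $h$; $\varphi\le_1\psi$ if moreover $h$ is injective; $\equiv_1$ means $\le_1$ in both directions. For total $\alpha,\beta$: writing $D_e$ for the finite set with canonical index $e$, $\alpha\le_{tt}\beta$ if there are total computable $p,q$ with $\alpha(x)=q(x,\beta\restriction D_{p(x)})$ for all $x$; $\alpha\le_{k\text{-btt}}\beta$ if moreover $|D_{p(x)}|\le k$ for all $x$. *)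

theory Defs
  imports Complex_Main "HOL-Library.Nat_Bijection"
begin

section \<open>Computability and relative computability\<close>

text \<open>
  Computability is formalized by Kleene's partial recursive functions, with the (possibly partial)
  function \<open>\<psi>\<close> as an additional initial function; a query outside its domain diverges.
  With \<open>\<psi>\<close> nowhere defined one obtains the partial computable functions, and with \<open>\<psi>\<close> total
  the usual notion of relative computability.
\<close>

datatype recf = Zero | Succ | Proj nat | Oracle | Comp recf "recf list" | PrimRec recf recf | Mu recf

inductive rec_eval :: "(nat \<rightharpoonup> nat) \<Rightarrow> recf \<Rightarrow> nat list \<Rightarrow> nat \<Rightarrow> bool"
  for \<psi> :: "nat \<rightharpoonup> nat" where
  zero: "rec_eval \<psi> Zero xs 0"
| succ: "rec_eval \<psi> Succ [x] (Suc x)"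
| proj: "i < length xs \<Longrightarrow> rec_eval \<psi> (Proj i) xs (xs ! i)"
| query: "\<psi> x = Some y \<Longrightarrow> rec_eval \<psi> Oracle [x] y"
| comp: "list_all2 (\<lambda>p y. rec_eval \<psi> p xs y) ps ys \<Longrightarrow> rec_eval \<psi> p ys z
    \<Longrightarrow> rec_eval \<psi> (Comp p ps) xs z"
| primrec_0: "rec_eval \<psi> p xs y \<Longrightarrow> rec_eval \<psi> (PrimRec p q) (0 # xs) y"
| primrec_Suc: "rec_eval \<psi> (PrimRec p q) (n # xs) y \<Longrightarrow> rec_eval \<psi> q (n # y # xs) z
    \<Longrightarrow> rec_eval \<psi> (PrimRec p q) (Suc n # xs) z"
| mu: "rec_eval \<psi> p (n # xs) 0 \<Longrightarrow> (\<forall>m<n. \<exists>y. rec_eval \<psi> p (m # xs) (Suc y))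
    \<Longrightarrow> rec_eval \<psi> (Mu p) xs n"

inductive_cases rec_eval_cases:
  "rec_eval \<psi> Zero xs y" "rec_eval \<psi> Succ xs y" "rec_eval \<psi> (Proj i) xs y"
  "rec_eval \<psi> Oracle xs y" "rec_eval \<psi> (Comp p ps) xs y"
  "rec_eval \<psi> (PrimRec p q) (0 # xs) y" "rec_eval \<psi> (PrimRec p q) (Suc n # xs) y"
  "rec_eval \<psi> (Mu p) xs y"

lemma rec_eval_deterministic:
  "rec_eval \<psi> p xs y \<Longrightarrow> rec_eval \<psi> p xs z \<Longrightarrow> y = z"
proof (induction arbitrary: z rule: rec_eval.induct)
  case (comp xs ps ys p w)
  from comp.prems obtain ys' where
    ys': "list_all2 (\<lambda>p y. rec_eval \<psi> p xs y) ps ys'" "rec_eval \<psi> p ys' z"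
    by (rule rec_eval_cases(5))
  have "ys = ys'"
    using comp.IH(1) ys'(1) unfolding list_all2_conv_all_nth by (metis nth_equalityI)
  then show ?case using comp.IH(2) ys'(2) by blast
next
  case (mu p n xs)
  from mu.prems have z: "rec_eval \<psi> p (z # xs) 0"
    "\<forall>m<z. \<exists>y. rec_eval \<psi> p (m # xs) (Suc y)"
    by (rule rec_eval_cases(8), blast)+
  have "\<not> z < n" using mu.IH(2) z(1) by fastforce
  moreover have "\<not> n < z" using mu.IH(1) z(2) by fastforce
  ultimately show ?case by simp
qed (erule rec_eval_cases, force)+

text \<open>The total computable functions on \<open>\<omega>\<close> and on \<open>\<omega> \<times> \<omega>\<close>.\<close>

definition computable :: "(nat \<Rightarrow> nat) \<Rightarrow> bool" where
  "computable f \<longleftrightarrow> (\<exists>p. \<forall>x. rec_eval Map.empty p [x] (f x))"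

definition computable2 :: "(nat \<Rightarrow> nat \<Rightarrow> nat) \<Rightarrow> bool" where
  "computable2 g \<longleftrightarrow> (\<exists>p. \<forall>x y. rec_eval Map.empty p [x, y] (g x y))"

definition approximable_from_above :: "(nat \<Rightarrow> nat) \<Rightarrow> bool" where
  "approximable_from_above f \<longleftrightarrow>
     (\<exists>g. computable2 g \<and> (\<forall>x s. g x (Suc s) \<le> g x s) \<and> (\<forall>x. (\<lambda>s. g x s) \<longlonglongrightarrow> f x))"


section \<open>Reducibilities and Turing degrees\<close>

definition turing_reducible :: "(nat \<rightharpoonup> nat) \<Rightarrow> (nat \<rightharpoonup> nat) \<Rightarrow> bool" where
  "turing_reducible \<phi> \<psi> \<longleftrightarrow> (\<exists>p. \<forall>x y. rec_eval \<psi> p [x] y \<longleftrightarrow> \<phi> x = Some y)"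

definition turing_equivalent :: "(nat \<rightharpoonup> nat) \<Rightarrow> (nat \<rightharpoonup> nat) \<Rightarrow> bool" where
  "turing_equivalent \<phi> \<psi> \<longleftrightarrow> turing_reducible \<phi> \<psi> \<and> turing_reducible \<psi> \<phi>"

text \<open>
  A Turing degree is a class of total functions. The argument is a partial function so that the
  distance function of a finite graph, a function with finite domain, has a degree too,
  namely that of the total computable functions.
\<close>

definition turing_degree :: "(nat \<rightharpoonup> nat) \<Rightarrow> (nat \<Rightarrow> nat) set" where
  "turing_degree \<phi> = {g. turing_equivalent (Some \<circ> g) \<phi>}"

definition one_reducible :: "(nat \<rightharpoonup> nat) \<Rightarrow> (nat \<rightharpoonup> nat) \<Rightarrow> bool" where
  "one_reducible \<phi> \<psi> \<longleftrightarrow> (\<exists>h. computable h \<and> inj h \<and> \<phi> = \<psi> \<circ> h)"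

definition one_equivalent :: "(nat \<rightharpoonup> nat) \<Rightarrow> (nat \<rightharpoonup> nat) \<Rightarrow> bool" where
  "one_equivalent \<phi> \<psi> \<longleftrightarrow> one_reducible \<phi> \<psi> \<and> one_reducible \<psi> \<phi>"

text \<open>
  The finite set with canonical index \<open>e\<close> is \<^term>\<open>set_decode e\<close>. A finite function is given to a
  computable function by the canonical index of its graph.
\<close>

definition restriction_code :: "(nat \<Rightarrow> nat) \<Rightarrow> nat set \<Rightarrow> nat" where
  "restriction_code \<beta> D = set_encode ((\<lambda>z. prod_encode (z, \<beta> z)) ` D)"

text \<open>
  Bounded truth-table reducibility is a relation between total functions; the definition below
  is false if one of the arguments is properly partial.
\<close>

definition btt_reducible :: "nat \<Rightarrow> (nat \<rightharpoonup> nat) \<Rightarrow> (nat \<rightharpoonup> nat) \<Rightarrow> bool" where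
  "btt_reducible k \<phi> \<psi> \<longleftrightarrow>
     (\<exists>\<alpha> \<beta>. \<phi> = Some \<circ> \<alpha> \<and> \<psi> = Some \<circ> \<beta> \<and>
       (\<exists>p q. computable p \<and> computable2 q \<and>
         (\<forall>x. \<alpha> x = q x (restriction_code \<beta> (set_decode (p x)))) \<and>
         (\<forall>x. card (set_decode (p x)) \<le> k)))"


section \<open>Graphs and their distance functions\<close>

record ngraph =
  verts :: "nat set"
  adj :: "nat \<Rightarrow> nat \<Rightarrow> bool"

definition is_graph :: "ngraph \<Rightarrow> bool" where
  "is_graph G \<longleftrightarrow>
     (\<forall>x y. adj G x y \<longrightarrow> x \<in> verts G \<and> y \<in> verts G) \<and>
     (\<forall>x y. adj G x y \<longrightarrow> adj G y x) \<and>
     (\<forall>x. \<not> adj G x x)"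

definition computable_graph :: "ngraph \<Rightarrow> bool" where
  "computable_graph G \<longleftrightarrow>
     is_graph G \<and> (verts G = UNIV \<or> (\<exists>n. verts G = {..<n})) \<and>
     computable2 (\<lambda>x y. of_bool (adj G x y))"

definition graph_isomorphic :: "ngraph \<Rightarrow> ngraph \<Rightarrow> bool" where
  "graph_isomorphic G H \<longleftrightarrow>
     (\<exists>h. bij_betw h (verts G) (verts H) \<and>
       (\<forall>x\<in>verts G. \<forall>y\<in>verts G. adj G x y \<longleftrightarrow> adj H (h x) (h y)))"

definition path_between :: "ngraph \<Rightarrow> nat \<Rightarrow> nat \<Rightarrow> nat list \<Rightarrow> bool" where
  "path_between G x y xs \<longleftrightarrow>
     xs \<noteq> [] \<and> hd xs = x \<and> last xs = y \<and> set xs \<subseteq> verts G \<and> distinct xs \<and> successively (adj G) xs"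

definition connected_graph :: "ngraph \<Rightarrow> bool" where
  "connected_graph G \<longleftrightarrow> (\<forall>x\<in>verts G. \<forall>y\<in>verts G. \<exists>xs. path_between G x y xs)"

text \<open>The length of a path is its number of edges.\<close>

definition graph_dist :: "ngraph \<Rightarrow> nat \<Rightarrow> nat \<Rightarrow> nat" where
  "graph_dist G x y = (LEAST n. \<exists>xs. path_between G x y xs \<and> length xs = Suc n)"

text \<open>
  The distance function as a function on \<open>\<omega>\<close>, by means of the pairing bijection
  \<^const>\<open>prod_encode\<close>. It is total iff the graph is connected and its domain is \<open>\<omega>\<close>.
\<close>

definition dist_fun :: "ngraph \<Rightarrow> nat \<rightharpoonup> nat" where
  "dist_fun G z =
     (case prod_decode z of (x, y) \<Rightarrow>
        if \<exists>xs. path_between G x y xs then Some (graph_dist G x y) else None)"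

definition dist_spectrum :: "ngraph \<Rightarrow> (nat \<Rightarrow> nat) set set" where
  "dist_spectrum G =
     {turing_degree (dist_fun H) | H. computable_graph H \<and> graph_isomorphic H G}"

end

theory Submission
  imports Defs
begin

text \<open>
  Take a ray \<open>e\<^sub>1, e\<^sub>2, \<dots>\<close>, cut into blocks, and a root. Whenever the
  approximation to \<open>f x\<close> has dropped to \<open>i\<close> or below, join the positions at distance
  \<open>i\<close> from the center of block \<open>x\<close> to the root by a path of length two. The center
  of block \<open>x\<close> then has distance \<open>f x + 2\<close> from the root, and the distance between
  two positions is attained along the ray or through the root, so that it depends on at most two values of
  \<open>f\<close>. The stages at which nothing is joined provide idle vertices, whence the domain is
  \<open>\<omega>\<close>; they are attached to the ray where they shorten no distance. Triangles along the
  ray make every vertex the only new common neighbour of two vertices already found, starting from finitely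
  many. Hence all computable copies are computably isomorphic.
\<close>

section \<open>Closure properties of relative computability\<close>

lemma rec_eval_mono:
  assumes "rec_eval Map.empty p xs y"
  shows "rec_eval \<psi> p xs y"
  using assms
proof (induction rule: rec_eval.induct)
  case (comp xs ps ys p z)
  from comp.IH(1) have "list_all2 (\<lambda>p y. rec_eval \<psi> p xs y) ps ys"
    by (auto elim: list.rel_mono_strong)
  then show ?case using comp.IH(2) by (rule rec_eval.comp)
next
  case (mu p n xs)
  then show ?case by (intro rec_eval.mu) blast+
qed (auto intro: rec_eval.intros)

primrec oracle_subst :: "recf \<Rightarrow> recf \<Rightarrow> recf" where
  "oracle_subst q Zero = Zero"
| "oracle_subst q Succ = Succ"
| "oracle_subst q (Proj i) = Proj i"
| "oracle_subst q Oracle = q"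
| "oracle_subst q (Comp p ps) = Comp (oracle_subst q p) (map (oracle_subst q) ps)"
| "oracle_subst q (PrimRec p r) = PrimRec (oracle_subst q p) (oracle_subst q r)"
| "oracle_subst q (Mu p) = Mu (oracle_subst q p)"

text \<open>Only convergent computations are transferred. For a total function this suffices, since
  \<open>rec_eval_deterministic\<close> excludes other values.\<close>

lemma rec_eval_oracle_subst:
  assumes "rec_eval \<phi> p xs y" and "\<And>x y. \<phi> x = Some y \<Longrightarrow> rec_eval \<psi> q [x] y"
  shows "rec_eval \<psi> (oracle_subst q p) xs y"
  using assms(1)
proof (induction rule: rec_eval.induct)
  case (comp xs ps ys p z)
  from comp.IH(1) have "list_all2 (\<lambda>p y. rec_eval \<psi> p xs y) (map (oracle_subst q) ps) ys"
    unfolding list_all2_map1 by (auto elim: list.rel_mono_strong)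
  then show ?case using comp.IH(2) by (auto intro: rec_eval.comp)
next
  case (mu p n xs)
  then show ?case unfolding oracle_subst.simps by (intro rec_eval.mu) blast+
qed (auto intro: rec_eval.intros assms(2))

lemma turing_reducible_totalI:
  assumes "\<And>x. rec_eval \<psi> p [x] (g x)"
  shows "turing_reducible (Some \<circ> g) \<psi>"
  unfolding turing_reducible_def using assms rec_eval_deterministic by fastforce

lemma turing_reducible_trans:
  assumes "turing_reducible (Some \<circ> g) \<phi>" "turing_reducible \<phi> \<psi>"
  shows "turing_reducible (Some \<circ> g) \<psi>"
proof -
  from assms(1) obtain p where p: "\<And>x. rec_eval \<phi> p [x] (g x)"
    unfolding turing_reducible_def by auto
  from assms(2) obtain q where q: "\<And>x y. \<phi> x = Some y \<Longrightarrow> rec_eval \<psi> q [x] y"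
    unfolding turing_reducible_def by auto
  have "rec_eval \<psi> (oracle_subst q p) [x] (g x)" for x
    using p q by (rule rec_eval_oracle_subst)
  then show ?thesis by (rule turing_reducible_totalI)
qed

lemma turing_degree_eq:
  assumes "turing_equivalent (Some \<circ> a) (Some \<circ> b)"
  shows "turing_degree (Some \<circ> a) = turing_degree (Some \<circ> b)"
  unfolding turing_degree_def
  using assms unfolding turing_equivalent_def by (blast intro: turing_reducible_trans)

text \<open>Functions take the whole argument list, so that closure lemmas apply as introduction
  rules to any body written with \<open>xs ! i\<close>.\<close>

definition rec_fun :: "(nat \<rightharpoonup> nat) \<Rightarrow> nat \<Rightarrow> (nat list \<Rightarrow> nat) \<Rightarrow> bool" where
  "rec_fun \<psi> n F \<longleftrightarrow> (\<exists>p. \<forall>xs. length xs = n \<longrightarrow> rec_eval \<psi> p xs (F xs))"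

lemma computable_iff_rec_fun: "computable f \<longleftrightarrow> rec_fun Map.empty 1 (\<lambda>xs. f (xs ! 0))"
  unfolding computable_def rec_fun_def by (force simp: length_Suc_conv)

lemma computable2_iff_rec_fun: "computable2 g \<longleftrightarrow> rec_fun Map.empty 2 (\<lambda>xs. g (xs ! 0) (xs ! 1))"
proof -
  have "(\<forall>xs. length xs = 2 \<longrightarrow> P xs) \<longleftrightarrow> (\<forall>x y. P [x, y])" for P :: "nat list \<Rightarrow> bool"
    by (auto simp: length_Suc_conv numeral_2_eq_2)
  then show ?thesis unfolding computable2_def rec_fun_def by simp
qed

lemma turing_reducibleI:
  assumes "rec_fun \<psi> 1 (\<lambda>xs. g (xs ! 0))"
  shows "turing_reducible (Some \<circ> g) \<psi>"
proof -
  obtain p where "\<And>x. rec_eval \<psi> p [x] (g x)"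
    using assms unfolding rec_fun_def by (force simp: length_Suc_conv)
  then show ?thesis by (rule turing_reducible_totalI)
qed

section \<open>Projections, composition and recursion\<close>

lemma rec_fun_cong:
  assumes "rec_fun \<psi> n F" "\<And>xs. length xs = n \<Longrightarrow> F xs = G xs"
  shows "rec_fun \<psi> n G"
  using assms unfolding rec_fun_def by metis

lemma rec_fun_proj: "i < n \<Longrightarrow> rec_fun \<psi> n (\<lambda>xs. xs ! i)"
  unfolding rec_fun_def by (metis rec_eval.proj)

text \<open>Minimization and recursion put their own variables in front, so the outer arguments
  reappear under one or two \<open>tl\<close>.\<close>

lemma rec_fun_proj_tl: "Suc i < n \<Longrightarrow> rec_fun \<psi> n (\<lambda>xs. tl xs ! i)"
  by (rule rec_fun_cong[OF rec_fun_proj[of "Suc i"]]) (auto simp: nth_tl)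

lemma rec_fun_proj_tl2: "Suc (Suc i) < n \<Longrightarrow> rec_fun \<psi> n (\<lambda>xs. tl (tl xs) ! i)"
  by (rule rec_fun_cong[OF rec_fun_proj[of "Suc (Suc i)"]]) (auto simp: nth_tl)

lemma rec_fun_comp:
  assumes "rec_fun \<psi> (length Fs) G" "\<forall>F\<in>set Fs. rec_fun \<psi> n F"
  shows "rec_fun \<psi> n (\<lambda>xs. G (map (\<lambda>F. F xs) Fs))"
proof -
  from assms(1) obtain p
    where p: "\<And>ys. length ys = length Fs \<Longrightarrow> rec_eval \<psi> p ys (G ys)"
    unfolding rec_fun_def by blast
  from assms(2) obtain P
    where P: "\<And>F xs. F \<in> set Fs \<Longrightarrow> length xs = n \<Longrightarrow> rec_eval \<psi> (P F) xs (F xs)"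
    unfolding rec_fun_def by metis
  have "rec_eval \<psi> (Comp p (map P Fs)) xs (G (map (\<lambda>F. F xs) Fs))" if "length xs = n" for xs
    by (rule rec_eval.comp[OF _ p]) (auto simp: list_all2_conv_all_nth P that)
  then show ?thesis unfolding rec_fun_def by blast
qed

lemma rec_fun_comp1:
  assumes "rec_fun \<psi> 1 (\<lambda>ys. f (ys ! 0))" "rec_fun \<psi> n F"
  shows "rec_fun \<psi> n (\<lambda>xs. f (F xs))"
  using rec_fun_comp[of \<psi> "[F]" "\<lambda>ys. f (ys ! 0)"] assms by simp

lemma rec_fun_comp2:
  assumes "rec_fun \<psi> 2 (\<lambda>ys. f (ys ! 0) (ys ! 1))" "rec_fun \<psi> n F" "rec_fun \<psi> n G"
  shows "rec_fun \<psi> n (\<lambda>xs. f (F xs) (G xs))"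
  using rec_fun_comp[of \<psi> "[F, G]" "\<lambda>ys. f (ys ! 0) (ys ! 1)"] assms
  by (simp add: numeral_2_eq_2)

lemma rec_fun_mono: "rec_fun Map.empty n F \<Longrightarrow> rec_fun \<psi> n F"
  unfolding rec_fun_def by (elim exE, intro exI allI impI, rule rec_eval_mono) blast

lemma rec_fun_computable:
  "computable f \<Longrightarrow> rec_fun \<psi> n F \<Longrightarrow> rec_fun \<psi> n (\<lambda>xs. f (F xs))"
  unfolding computable_iff_rec_fun by (rule rec_fun_comp1[of _ f, OF rec_fun_mono])

lemma rec_fun_computable2:
  "computable2 f \<Longrightarrow> rec_fun \<psi> n F \<Longrightarrow> rec_fun \<psi> n G \<Longrightarrow> rec_fun \<psi> n (\<lambda>xs. f (F xs) (G xs))"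
  unfolding computable2_iff_rec_fun by (rule rec_fun_comp2[of _ f, OF rec_fun_mono])

lemma rec_fun_oracle: "rec_fun (Some \<circ> f) n F \<Longrightarrow> rec_fun (Some \<circ> f) n (\<lambda>xs. f (F xs))"
proof (rule rec_fun_comp1[of _ f])
  have "rec_eval (Some \<circ> f) Oracle [x] (f x)" for x by (rule rec_eval.query) simp
  then show "rec_fun (Some \<circ> f) 1 (\<lambda>ys. f (ys ! 0))"
    unfolding rec_fun_def by (intro exI[of _ Oracle]) (auto simp: length_Suc_conv)
qed

lemma rec_fun_Suc: "rec_fun \<psi> n F \<Longrightarrow> rec_fun \<psi> n (\<lambda>xs. Suc (F xs))"
proof (rule rec_fun_comp1[of _ Suc])
  show "rec_fun \<psi> 1 (\<lambda>ys. Suc (ys ! 0))"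
    unfolding rec_fun_def
    by (intro exI[of _ Succ]) (auto simp: length_Suc_conv intro: rec_eval.succ)
qed

lemma rec_fun_const: "rec_fun \<psi> n (\<lambda>xs. c)"
proof (induction c)
  case 0
  show ?case unfolding rec_fun_def by (blast intro: rec_eval.zero)
qed (rule rec_fun_Suc)

lemma rec_fun_rec_nat:
  assumes A: "rec_fun \<psi> n A" and B: "rec_fun \<psi> (Suc (Suc n)) (\<lambda>ys. B (ys ! 0) (ys ! 1) (tl (tl ys)))"
    and N: "rec_fun \<psi> n N"
  shows "rec_fun \<psi> n (\<lambda>xs. rec_nat (A xs) (\<lambda>k y. B k y xs) (N xs))"
proof -
  from A obtain p where p: "\<And>xs. length xs = n \<Longrightarrow> rec_eval \<psi> p xs (A xs)"
    unfolding rec_fun_def by blast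
  from B obtain q where q: "\<And>ys. length ys = Suc (Suc n) \<Longrightarrow>
      rec_eval \<psi> q ys (B (ys ! 0) (ys ! 1) (tl (tl ys)))"
    unfolding rec_fun_def by blast
  from N obtain r where r: "\<And>xs. length xs = n \<Longrightarrow> rec_eval \<psi> r xs (N xs)"
    unfolding rec_fun_def by blast
  have q': "rec_eval \<psi> q (k # y # xs) (B k y xs)" if "length xs = n" for k y xs
    using q[of "k # y # xs"] that by simp
  have PR: "rec_eval \<psi> (PrimRec p q) (m # xs) (rec_nat (A xs) (\<lambda>k y. B k y xs) m)"
    if "length xs = n" for m xs
  proof (induction m)
    case 0
    show ?case using rec_eval.primrec_0[OF p[OF that]] by simp
  next
    case (Suc m)
    show ?case using rec_eval.primrec_Suc[OF Suc q'[OF that]] by simp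
  qed
  \<comment> \<open>\<open>PrimRec\<close> recurses on its first argument; \<open>r\<close> supplies
    it and the projections pass the parameters on.\<close>
  have "rec_eval \<psi> (Comp (PrimRec p q) (r # map Proj [0..<n])) xs
      (rec_nat (A xs) (\<lambda>k y. B k y xs) (N xs))" if "length xs = n" for xs
  proof (rule rec_eval.comp[OF _ PR[OF that]])
    show "list_all2 (\<lambda>p y. rec_eval \<psi> p xs y) (r # map Proj [0..<n]) (N xs # xs)"
      unfolding list_all2_Cons
    proof
      show "rec_eval \<psi> r xs (N xs)" using that by (rule r)
      show "list_all2 (\<lambda>p y. rec_eval \<psi> p xs y) (map Proj [0..<n]) xs"
        unfolding list_all2_conv_all_nth using that by (simp add: rec_eval.proj)
    qed
  qed
  then show ?thesis unfolding rec_fun_def by blast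
qed

section \<open>Arithmetic, decidable predicates and search\<close>

lemma rec_fun_add:
  assumes "rec_fun \<psi> n F" "rec_fun \<psi> n G"
  shows "rec_fun \<psi> n (\<lambda>xs. F xs + G xs)"
proof -
  have "a + b = rec_nat a (\<lambda>k y. Suc y) b" for a b :: nat by (induction b) auto
  then show ?thesis
    by (simp only:) (intro rec_fun_rec_nat rec_fun_Suc rec_fun_proj assms, simp)
qed

lemma rec_fun_pred: "rec_fun \<psi> n F \<Longrightarrow> rec_fun \<psi> n (\<lambda>xs. F xs - Suc 0)"
proof -
  assume F: "rec_fun \<psi> n F"
  have "a - Suc 0 = rec_nat 0 (\<lambda>k y. k) a" for a by (induction a) auto
  then show ?thesis
    by (simp only:) (intro rec_fun_rec_nat rec_fun_const rec_fun_proj F, simp)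
qed

lemma rec_fun_diff:
  assumes "rec_fun \<psi> n F" "rec_fun \<psi> n G"
  shows "rec_fun \<psi> n (\<lambda>xs. F xs - G xs)"
proof -
  have "rec_nat a (\<lambda>k y. y - Suc 0) b = a - b" for a b :: nat by (induction b) auto
  moreover have "rec_fun \<psi> n (\<lambda>xs. rec_nat (F xs) (\<lambda>k y. y - Suc 0) (G xs))"
    by (intro rec_fun_rec_nat rec_fun_pred rec_fun_proj assms) simp
  ultimately show ?thesis by simp
qed

lemma rec_fun_mult:
  assumes "rec_fun \<psi> n F" "rec_fun \<psi> n G"
  shows "rec_fun \<psi> n (\<lambda>xs. F xs * G xs)"
proof -
  have "a * b = rec_nat 0 (\<lambda>k y. y + a) b" for a b :: nat by (induction b) auto
  then have "rec_fun \<psi> 2 (\<lambda>ys. ys ! 0 * ys ! 1)"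
    by (simp only:)
      (intro rec_fun_rec_nat rec_fun_add rec_fun_const rec_fun_proj rec_fun_proj_tl2; simp)
  then show ?thesis using assms by (rule rec_fun_comp2)
qed

lemma rec_fun_power:
  assumes "rec_fun \<psi> n F" "rec_fun \<psi> n G"
  shows "rec_fun \<psi> n (\<lambda>xs. F xs ^ G xs)"
proof -
  have "a ^ b = rec_nat 1 (\<lambda>k y. y * a) b" for a b :: nat by (induction b) auto
  then have "rec_fun \<psi> 2 (\<lambda>ys. ys ! 0 ^ ys ! 1)"
    by (simp only:)
      (intro rec_fun_rec_nat rec_fun_mult rec_fun_const rec_fun_proj rec_fun_proj_tl2; simp)
  then show ?thesis using assms by (rule rec_fun_comp2)
qed

lemma rec_fun_not:
  assumes "rec_fun \<psi> n (\<lambda>xs. of_bool (P xs))"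
  shows "rec_fun \<psi> n (\<lambda>xs. of_bool (\<not> P xs))"
  by (rule rec_fun_cong[OF rec_fun_diff[OF rec_fun_const[of _ _ 1] assms]]) auto

lemma rec_fun_conj:
  assumes "rec_fun \<psi> n (\<lambda>xs. of_bool (P xs))" "rec_fun \<psi> n (\<lambda>xs. of_bool (Q xs))"
  shows "rec_fun \<psi> n (\<lambda>xs. of_bool (P xs \<and> Q xs))"
  by (rule rec_fun_cong[OF rec_fun_mult[OF assms]]) auto

lemma rec_fun_disj:
  assumes "rec_fun \<psi> n (\<lambda>xs. of_bool (P xs))" "rec_fun \<psi> n (\<lambda>xs. of_bool (Q xs))"
  shows "rec_fun \<psi> n (\<lambda>xs. of_bool (P xs \<or> Q xs))"
  by (rule rec_fun_cong[OF rec_fun_not[OF rec_fun_conj[OF assms[THEN rec_fun_not]]]]) auto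

lemma rec_fun_le:
  assumes "rec_fun \<psi> n F" "rec_fun \<psi> n G"
  shows "rec_fun \<psi> n (\<lambda>xs. of_bool (F xs \<le> G xs))"
  by (rule rec_fun_cong[OF rec_fun_diff[OF rec_fun_const[of _ _ 1] rec_fun_diff[OF assms]]]) auto

lemma rec_fun_less:
  assumes "rec_fun \<psi> n F" "rec_fun \<psi> n G"
  shows "rec_fun \<psi> n (\<lambda>xs. of_bool (F xs < G xs))"
  unfolding less_eq_Suc_le by (intro rec_fun_le rec_fun_Suc assms)

lemma rec_fun_eq:
  assumes "rec_fun \<psi> n F" "rec_fun \<psi> n G"
  shows "rec_fun \<psi> n (\<lambda>xs. of_bool (F xs = G xs))"
  unfolding order_eq_iff by (intro rec_fun_le rec_fun_conj assms)

lemma rec_fun_If: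
  assumes "rec_fun \<psi> n (\<lambda>xs. of_bool (P xs))" "rec_fun \<psi> n F" "rec_fun \<psi> n G"
  shows "rec_fun \<psi> n (\<lambda>xs. if P xs then F xs else G xs)"
  by (rule rec_fun_cong[OF rec_fun_add[OF rec_fun_mult[OF assms(1,2)]
        rec_fun_mult[OF rec_fun_not[OF assms(1)] assms(3)]]]) auto

lemma rec_fun_of_bool_If:
  assumes "rec_fun \<psi> n (\<lambda>xs. of_bool (P xs))" "rec_fun \<psi> n (\<lambda>xs. of_bool (Q xs))"
    "rec_fun \<psi> n (\<lambda>xs. of_bool (R xs))"
  shows "rec_fun \<psi> n (\<lambda>xs. of_bool (if P xs then Q xs else R xs))"
  by (rule rec_fun_cong[OF rec_fun_If[OF assms]]) auto

text \<open>\<open>Mu\<close> looks for a zero, hence the program for the negated predicate. By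
  \<open>ex\<close> the search ends on every input.\<close>

lemma rec_fun_Least:
  assumes P: "rec_fun \<psi> (Suc n) (\<lambda>ys. of_bool (P (ys ! 0) (tl ys)))"
    and ex: "\<And>xs. length xs = n \<Longrightarrow> \<exists>k. P k xs"
  shows "rec_fun \<psi> n (\<lambda>xs. LEAST k. P k xs)"
proof -
  obtain p where p: "\<And>ys. length ys = Suc n \<Longrightarrow>
      rec_eval \<psi> p ys (of_bool (\<not> P (ys ! 0) (tl ys)))"
    using rec_fun_not[OF P] unfolding rec_fun_def by auto
  have "rec_eval \<psi> (Mu p) xs (LEAST k. P k xs)" if len: "length xs = n" for xs
  proof (rule rec_eval.mu)
    have p': "rec_eval \<psi> p (k # xs) (of_bool (\<not> P k xs))" for k
      using p[of "k # xs"] len by simp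
    show "rec_eval \<psi> p ((LEAST k. P k xs) # xs) 0"
      using p'[of "LEAST k. P k xs"] LeastI_ex[OF ex[OF len]] by simp
    show "\<forall>m<LEAST k. P k xs. \<exists>y. rec_eval \<psi> p (m # xs) (Suc y)"
    proof (intro allI impI)
      fix m assume "m < (LEAST k. P k xs)"
      then have "\<not> P m xs" by (rule not_less_Least)
      then show "\<exists>y. rec_eval \<psi> p (m # xs) (Suc y)" using p'[of m] by auto
    qed
  qed
  then show ?thesis unfolding rec_fun_def by blast
qed

lemma rec_fun_min:
  assumes "rec_fun \<psi> n F" "rec_fun \<psi> n G"
  shows "rec_fun \<psi> n (\<lambda>xs. min (F xs) (G xs))"
  unfolding min_def by (intro rec_fun_If rec_fun_le assms)

lemmas rec_fun_arith = rec_fun_const rec_fun_proj rec_fun_proj_tl rec_fun_proj_tl2 rec_fun_Suc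
  rec_fun_add rec_fun_diff rec_fun_mult rec_fun_power rec_fun_not rec_fun_conj rec_fun_disj
  rec_fun_le rec_fun_less rec_fun_eq rec_fun_If rec_fun_of_bool_If rec_fun_min

section \<open>Division, remainder and pairing\<close>

lemma rec_fun_div:
  assumes "rec_fun \<psi> n F" "rec_fun \<psi> n G"
  shows "rec_fun \<psi> n (\<lambda>xs. F xs div G xs)"
proof -
  \<comment> \<open>The disjunct \<open>b = 0\<close> makes the search end for divisor 0 too; the
    outer conditional then gives the value 0.\<close>
  have "a div b = (if b = 0 then 0 else LEAST q. b = 0 \<or> a < Suc q * b)" for a b :: nat
  proof (cases "b = 0")
    case False
    then have "(LEAST q. b = 0 \<or> a < Suc q * b) = a div b"
      by (intro Least_equality) (auto simp flip: div_less_iff_less_mult simp del: mult_Suc)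
    with False show ?thesis by simp
  qed simp
  moreover have "rec_fun \<psi> 2 (\<lambda>ys. if ys ! 1 = 0 then 0 else LEAST q. ys ! 1 = 0 \<or> ys ! 0 < Suc q * ys ! 1)"
  proof (intro rec_fun_If rec_fun_Least)
    fix xs :: "nat list"
    have "xs ! 1 = 0 \<or> xs ! 0 < Suc (xs ! 0) * xs ! 1" by (cases "xs ! 1") auto
    then show "\<exists>k. xs ! 1 = 0 \<or> xs ! 0 < Suc k * xs ! 1" by blast
  qed (intro rec_fun_arith; simp)+
  ultimately have "rec_fun \<psi> 2 (\<lambda>ys. ys ! 0 div ys ! 1)" by (simp only:)
  then show ?thesis using assms by (rule rec_fun_comp2)
qed

lemma rec_fun_mod:
  assumes "rec_fun \<psi> n F" "rec_fun \<psi> n G"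
  shows "rec_fun \<psi> n (\<lambda>xs. F xs mod G xs)"
  unfolding modulo_nat_def by (intro rec_fun_div rec_fun_arith assms)

lemma rec_fun_triangle: "rec_fun \<psi> n F \<Longrightarrow> rec_fun \<psi> n (\<lambda>xs. triangle (F xs))"
  unfolding triangle_def by (intro rec_fun_div rec_fun_arith)

lemma rec_fun_prod_encode:
  "rec_fun \<psi> n F \<Longrightarrow> rec_fun \<psi> n G \<Longrightarrow> rec_fun \<psi> n (\<lambda>xs. prod_encode (F xs, G xs))"
  unfolding prod_encode_def split by (intro rec_fun_arith rec_fun_triangle)

text \<open>\<open>prod_encode (a, b) = triangle (a + b) + a\<close>, and \<open>s z\<close> is the
  index \<open>a + b\<close> of the diagonal through \<open>z\<close>, which a search can
  find.\<close>

lemma prod_decode_Least: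
  defines "s z \<equiv> LEAST s. z < triangle (Suc s)"
  shows "fst (prod_decode z) = z - triangle (s z)"
    and "snd (prod_decode z) = s z - (z - triangle (s z))"
proof -
  obtain a b where z: "z = prod_encode (a, b)" by (metis prod_decode_inverse surj_pair)
  have mono: "triangle (Suc m) \<le> triangle k" if "m < k" for m k
    using that by (induction k) (auto simp: less_Suc_eq)
  have "s z = a + b"
    unfolding s_def
  proof (rule Least_equality)
    show "z < triangle (Suc (a + b))" by (simp add: z prod_encode_def)
    show "a + b \<le> y" if "z < triangle (Suc y)" for y
      using mono[of y "a + b"] that by (force simp: z prod_encode_def)
  qed
  then show "fst (prod_decode z) = z - triangle (s z)"
    and "snd (prod_decode z) = s z - (z - triangle (s z))"
    unfolding z prod_encode_inverse by (simp_all add: prod_encode_def)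
qed

lemma rec_fun_prod_decode:
  assumes "rec_fun \<psi> n F"
  shows "rec_fun \<psi> n (\<lambda>xs. fst (prod_decode (F xs)))"
    and "rec_fun \<psi> n (\<lambda>xs. snd (prod_decode (F xs)))"
proof -
  have ex: "\<exists>s. z < triangle (Suc s)" for z
    by (rule exI[of _ z]) simp
  have s: "rec_fun \<psi> 1 (\<lambda>xs. LEAST s. xs ! 0 < triangle (Suc s))"
    by (rule rec_fun_Least[OF _ ex]) (intro rec_fun_arith rec_fun_triangle; simp)
  have fst: "rec_fun \<psi> 1 (\<lambda>xs. fst (prod_decode (xs ! 0)))"
    and snd: "rec_fun \<psi> 1 (\<lambda>xs. snd (prod_decode (xs ! 0)))"
    unfolding prod_decode_Least by (intro s rec_fun_arith rec_fun_triangle; simp)+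
  show "rec_fun \<psi> n (\<lambda>xs. fst (prod_decode (F xs)))" using fst assms by (rule rec_fun_comp1)
  show "rec_fun \<psi> n (\<lambda>xs. snd (prod_decode (F xs)))" using snd assms by (rule rec_fun_comp1)
qed

lemmas rec_fun_intros = rec_fun_arith rec_fun_div rec_fun_mod rec_fun_prod_encode rec_fun_prod_decode


section \<open>Distances from a local criterion\<close>

lemma path_between_Cons:
  assumes "path_between G u' v xs" "adj G u u'" "u \<in> verts G" "u \<notin> set xs"
  shows "path_between G u v (u # xs)"
  using assms unfolding path_between_def by (cases xs) auto

text \<open>By \<open>step\<close>, one edge lowers \<open>D\<close> by at most 1, so no path is
  shorter than \<open>D u v\<close>; following \<open>descent\<close> gives a path of exactly this
  length.\<close>

lemma graph_dist_eqI:
  fixes D :: "nat \<Rightarrow> nat \<Rightarrow> nat"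
  assumes V: "verts G = UNIV"
    and zero: "\<And>v. D v v = 0"
    and step: "\<And>u u' v. adj G u u' \<Longrightarrow> D u v \<le> Suc (D u' v)"
    and descent: "\<And>u v. u \<noteq> v \<Longrightarrow> \<exists>u'. adj G u u' \<and> Suc (D u' v) \<le> D u v"
  shows "\<exists>xs. path_between G u v xs" and "graph_dist G u v = D u v"
proof -
  \<comment> \<open>The bound on \<open>D\<close> along the path keeps it simple: the vertex added
    in front has the larger value \<open>Suc n\<close>.\<close>
  have upper: "\<exists>xs. path_between G u v xs \<and> length xs = Suc n \<and> (\<forall>z\<in>set xs. D z v \<le> n)"
    if "D u v = n" for u n
    using that
  proof (induction n arbitrary: u)
    case 0
    then have "u = v" using descent[of u v] by fastforce
    then have "path_between G u v [u]" unfolding path_between_def by (simp add: V)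
    with 0 show ?case by (intro exI[of _ "[u]"]) simp
  next
    case (Suc n)
    then have "u \<noteq> v" using zero by force
    then obtain u' where u': "adj G u u'" "Suc (D u' v) \<le> D u v" using descent by blast
    with step[OF u'(1), of v] Suc.prems have "D u' v = n" by simp
    from Suc.IH[OF this] obtain xs where xs: "path_between G u' v xs" "length xs = Suc n"
      "\<forall>z\<in>set xs. D z v \<le> n" by blast
    then have "u \<notin> set xs" using Suc.prems by fastforce
    with xs u' Suc.prems show ?case
      by (intro exI[of _ "u # xs"]) (auto simp: V intro: path_between_Cons)
  qed
  have lower: "D u v < length xs"
    if "xs \<noteq> []" "hd xs = u" "last xs = v" "successively (adj G) xs" for xs u
    using that
  proof (induction xs arbitrary: u)
    case (Cons x xs)
    show ?case
    proof (cases "xs = []")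
      case True
      with Cons.prems show ?thesis by (simp add: zero)
    next
      case False
      with Cons.prems have "adj G u (hd xs)" by (cases xs) auto
      moreover have "D (hd xs) v < length xs"
        using Cons.IH[OF False refl] Cons.prems False by (cases xs) auto
      ultimately show ?thesis using step[of u "hd xs" v] by simp
    qed
  qed simp
  from upper[OF refl] obtain xs where xs: "path_between G u v xs" "length xs = Suc (D u v)"
    by blast
  then show "\<exists>xs. path_between G u v xs" by blast
  show "graph_dist G u v = D u v"
    unfolding graph_dist_def
  proof (rule Least_equality)
    show "\<exists>xs. path_between G u v xs \<and> length xs = Suc (D u v)" using xs by blast
    fix n assume "\<exists>xs. path_between G u v xs \<and> length xs = Suc n"
    then show "D u v \<le> n" using lower unfolding path_between_def by fastforce
  qed
qed


section \<open>A rigid graph with prescribed distances\<close>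

text \<open>
  \<open>Main 0\<close> is the root and \<open>Main 1, Main 2, \<dots>\<close> is the ray. \<open>Helper t\<close> makes the ray recognizable
  without changing distances on it. \<open>Opt n\<close> joins the root to \<open>Main (tgt n)\<close> if \<open>act n\<close>;
  otherwise it is idle, a bridge over \<open>Main (n + 2)\<close> that shortens no distance.
\<close>

datatype node = Main nat | Helper nat | Opt nat

definition node_of :: "nat \<Rightarrow> node" where
  "node_of v = (if v mod 3 = 0 then Main (v div 3)
     else if v mod 3 = 1 then Helper (v div 3) else Opt (v div 3))"

primrec code_of :: "node \<Rightarrow> nat" where
  "code_of (Main a) = 3 * a"
| "code_of (Helper t) = Suc (3 * t)"
| "code_of (Opt n) = Suc (Suc (3 * n))"

lemma node_of_code_of [simp]: "node_of (code_of u) = u"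
  by (cases u) (simp_all add: node_of_def, presburger+)

lemma code_of_node_of [simp]: "code_of (node_of v) = v"
  unfolding node_of_def by simp presburger

primrec height :: "node \<Rightarrow> nat" where
  "height (Main a) = 0"
| "height (Helper t) = 1"
| "height (Opt n) = 1"

text \<open>\<open>link1\<close>, \<open>link2\<close> and \<open>link3\<close> list the main
  neighbours of a \<open>Helper\<close> or \<open>Opt\<close> node, with a repetition if there are
  only two. A main node is its own link, so that one distance formula serves all nodes.\<close>

primrec link1 :: "(nat \<Rightarrow> bool) \<Rightarrow> (nat \<Rightarrow> nat) \<Rightarrow> node \<Rightarrow> nat" where
  "link1 act tgt (Main a) = a"
| "link1 act tgt (Helper t) = Suc t"
| "link1 act tgt (Opt n) = (if act n then 0 else Suc n)"

primrec link2 :: "(nat \<Rightarrow> bool) \<Rightarrow> (nat \<Rightarrow> nat) \<Rightarrow> node \<Rightarrow> nat" where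
  "link2 act tgt (Main a) = a"
| "link2 act tgt (Helper t) = t + 2"
| "link2 act tgt (Opt n) = (if act n then tgt n else n + 3)"

primrec link3 :: "(nat \<Rightarrow> bool) \<Rightarrow> (nat \<Rightarrow> nat) \<Rightarrow> node \<Rightarrow> nat" where
  "link3 act tgt (Main a) = a"
| "link3 act tgt (Helper t) = t + 3"
| "link3 act tgt (Opt n) = (if act n then tgt n else n + 3)"

definition linked :: "(nat \<Rightarrow> bool) \<Rightarrow> (nat \<Rightarrow> nat) \<Rightarrow> nat \<Rightarrow> node \<Rightarrow> bool" where
  "linked act tgt a u \<longleftrightarrow> a = link1 act tgt u \<or> a = link2 act tgt u \<or> a = link3 act tgt u"

definition min_link :: "(nat \<Rightarrow> bool) \<Rightarrow> (nat \<Rightarrow> nat) \<Rightarrow> node \<Rightarrow> (nat \<Rightarrow> nat) \<Rightarrow> nat" where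
  "min_link act tgt u F =
     min (F (link1 act tgt u)) (min (F (link2 act tgt u)) (F (link3 act tgt u)))"

lemma min_link_le: "linked act tgt a u \<Longrightarrow> min_link act tgt u F \<le> F a"
  unfolding linked_def min_link_def by auto

lemma min_link_attained: "\<exists>a. linked act tgt a u \<and> min_link act tgt u F = F a"
  unfolding linked_def min_link_def min_def by auto

primrec edge :: "(nat \<Rightarrow> bool) \<Rightarrow> (nat \<Rightarrow> nat) \<Rightarrow> node \<Rightarrow> node \<Rightarrow> bool" where
  "edge act tgt (Main a) v = (case v of
     Main b \<Rightarrow> a \<noteq> 0 \<and> b \<noteq> 0 \<and> (a = Suc b \<or> b = Suc a)
   | Helper t \<Rightarrow> linked act tgt a (Helper t) | Opt n \<Rightarrow> linked act tgt a (Opt n))"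
| "edge act tgt (Helper t) v =
     (case v of Main b \<Rightarrow> linked act tgt b (Helper t) | Helper s \<Rightarrow> False | Opt n \<Rightarrow> False)"
| "edge act tgt (Opt n) v =
     (case v of Main b \<Rightarrow> linked act tgt b (Opt n) | Helper s \<Rightarrow> False | Opt m \<Rightarrow> False)"

text \<open>
  The distance on main nodes, if \<open>\<delta> p\<close> is the distance along the ray from \<open>Main p\<close> to the nearest
  node joined to the root: either go along the ray or through the root. The functions \<open>\<delta>\<close> and
  \<open>\<delta>'\<close> for the two arguments are kept apart because later each one is computed from a single
  value of \<open>f\<close>.
\<close>

definition root_dist :: "(nat \<Rightarrow> nat) \<Rightarrow> nat \<Rightarrow> nat" where
  "root_dist \<delta> a = (if a = 0 then 0 else 2 + \<delta> a)"

definition main_dist :: "(nat \<Rightarrow> nat) \<Rightarrow> (nat \<Rightarrow> nat) \<Rightarrow> nat \<Rightarrow> nat \<Rightarrow> nat" where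
  "main_dist \<delta> \<delta>' a b =
     (if a = 0 \<or> b = 0 then root_dist \<delta> a + root_dist \<delta>' b
      else min ((a - b) + (b - a)) (root_dist \<delta> a + root_dist \<delta>' b))"

text \<open>A shortest path leaves \<open>u\<close> and enters \<open>v\<close> through links. The
  case \<open>u = v\<close> is separate because at height 1 the formula would count the detour to a
  link and back.\<close>

definition node_dist ::
    "(nat \<Rightarrow> bool) \<Rightarrow> (nat \<Rightarrow> nat) \<Rightarrow> (nat \<Rightarrow> nat) \<Rightarrow> (nat \<Rightarrow> nat) \<Rightarrow> node \<Rightarrow> node \<Rightarrow> nat" where
  "node_dist act tgt \<delta> \<delta>' u v =
     (if u = v then 0 else height u + height v +
        min_link act tgt u (\<lambda>a. min_link act tgt v (\<lambda>b. main_dist \<delta> \<delta>' a b)))"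

text \<open>On the ray, \<open>\<delta>\<close> is the distance to its zero set: it changes by at
  most 1 per step and falls towards some neighbour where positive. The active indices correspond
  bijectively to the zeros, so each zero has one shortcut.\<close>

locale shortcut_graph =
  fixes act :: "nat \<Rightarrow> bool" and tgt :: "nat \<Rightarrow> nat" and \<delta> :: "nat \<Rightarrow> nat"
  assumes slope: "p \<noteq> 0 \<Longrightarrow> \<delta> p \<le> Suc (\<delta> (Suc p))" "p \<noteq> 0 \<Longrightarrow> \<delta> (Suc p) \<le> Suc (\<delta> p)"
    and downhill: "p \<noteq> 0 \<Longrightarrow> \<delta> p \<noteq> 0 \<Longrightarrow> \<exists>q. q \<noteq> 0 \<and> (q = Suc p \<or> p = Suc q) \<and> Suc (\<delta> q) \<le> \<delta> p"
    and act_tgt: "act n \<Longrightarrow> tgt n \<noteq> 0 \<and> \<delta> (tgt n) = 0"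
    and act_inj: "act m \<Longrightarrow> act n \<Longrightarrow> tgt m = tgt n \<Longrightarrow> m = n"
    and act_surj: "p \<noteq> 0 \<Longrightarrow> \<delta> p = 0 \<Longrightarrow> \<exists>n. act n \<and> tgt n = p"
begin

abbreviation "lk \<equiv> linked act tgt"
abbreviation "E \<equiv> edge act tgt"
abbreviation "D0 \<equiv> main_dist \<delta> \<delta>"
abbreviation "D \<equiv> node_dist act tgt \<delta> \<delta>"

section \<open>The distance formula along an edge\<close>

lemma lk_simps [simp]:
  "lk a (Main b) \<longleftrightarrow> a = b"
  "lk a (Helper t) \<longleftrightarrow> a = Suc t \<or> a = t + 2 \<or> a = t + 3"
  "lk a (Opt n) \<longleftrightarrow> (if act n then a = 0 \<or> a = tgt n else a = Suc n \<or> a = n + 3)"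
  by (auto simp: linked_def)

lemma E_sym: "E u v \<Longrightarrow> E v u"
  by (cases u; cases v) auto

lemma E_irrefl: "\<not> E u u"
  by (cases u) auto

lemma slope_add: "p \<noteq> 0 \<Longrightarrow> \<delta> p \<le> \<delta> (p + k) + k \<and> \<delta> (p + k) \<le> \<delta> p + k"
proof (induction k)
  case (Suc k)
  then show ?case using slope[of "p + k"] by simp
qed simp

lemma slope_gap: "p \<noteq> 0 \<Longrightarrow> q \<noteq> 0 \<Longrightarrow> \<delta> p \<le> \<delta> q + ((p - q) + (q - p))"
  using slope_add[of p "q - p"] slope_add[of q "p - q"] by (cases "p \<le> q") auto

lemma D0_self: "D0 a a = 0"
  unfolding main_dist_def root_dist_def by simp

lemma D0_ray_edge:
  assumes "a \<noteq> 0" "a' \<noteq> 0" "a = Suc a' \<or> a' = Suc a"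
  shows "D0 a b \<le> Suc (D0 a' b)"
  using assms slope[of a] slope[of a'] unfolding main_dist_def root_dist_def by auto

text \<open>Links of a helper or an idle node are at most two apart on the ray, so the slope bound
  applies; those of an active node are the root and a zero of \<open>\<delta>\<close>.\<close>

lemma D0_two_step:
  assumes "lk a u" "lk a' u" "height u = 1"
  shows "D0 a b \<le> D0 a' b + 2"
proof -
  have near: "D0 p b \<le> D0 q b + 2"
    if "p \<noteq> 0" "q \<noteq> 0" "p \<le> q + 2" "q \<le> p + 2" for p q
    using that slope_gap[of p q] unfolding main_dist_def root_dist_def by auto
  show ?thesis
  proof (cases u)
    case (Opt n)
    show ?thesis
    proof (cases "act n")
      case True
      note t = act_tgt[OF True]
      \<comment> \<open>Hence \<open>2 + \<delta> b\<close>, the distance from \<open>b\<close> to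
        the root, exceeds the ray distance from \<open>b\<close> to \<open>tgt n\<close> by at most
        2.\<close>
      have "\<delta> b \<le> (tgt n - b) + (b - tgt n)" if "b \<noteq> 0"
        using slope_gap[of b "tgt n"] t that by simp
      then show ?thesis using True assms Opt t
        unfolding main_dist_def root_dist_def by auto
    qed (use Opt assms near in auto)
  qed (use assms near in auto)
qed

lemma D_self: "D u u = 0"
  by (simp add: node_dist_def)

lemma D_le:
  "lk a u \<Longrightarrow> lk b v \<Longrightarrow> D u v \<le> height u + height v + D0 a b"
  using min_link_le[of act tgt a u "\<lambda>a. min_link act tgt v (D0 a)"]
    min_link_le[of act tgt b v "D0 a"]
  unfolding node_dist_def by simp

lemma D_attained:
  "u \<noteq> v \<Longrightarrow> \<exists>a b. lk a u \<and> lk b v \<and> D u v = height u + height v + D0 a b"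
  unfolding node_dist_def using min_link_attained by (simp, metis)

text \<open>Both directions are needed for \<open>D_step\<close>: every edge has a main endpoint,
  but it may be either end.\<close>

lemma D_step_main:
  assumes "E (Main a) u"
  shows "D (Main a) v \<le> Suc (D u v)" and "D u v \<le> Suc (D (Main a) v)"
proof -
  consider b where "u = Main b" "a \<noteq> 0" "b \<noteq> 0" "a = Suc b \<or> b = Suc a"
    | "height u = 1" "lk a u" using assms by (cases u) auto
  then have "D (Main a) v \<le> Suc (D u v) \<and> D u v \<le> Suc (D (Main a) v)"
  proof cases
    case 1
    have "D (Main p) v \<le> Suc (D (Main q) v)"
      if "p \<noteq> 0" "q \<noteq> 0" "p = Suc q \<or> q = Suc p" for p q
    proof (cases "Main q = v")
      case True
      then have "D (Main p) v \<le> D0 p q" using D_le[of p "Main p" q v] by auto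
      also have "\<dots> \<le> 1" using D0_ray_edge[OF that, of q] D0_self by simp
      finally show ?thesis by simp
    next
      case False
      then obtain c where "lk c v" "D (Main q) v = height v + D0 q c"
        using D_attained[of "Main q" v] by auto
      then show ?thesis using D_le[of p "Main p" c v] D0_ray_edge[OF that, of c] by simp
    qed
    with 1 show ?thesis by metis
  next
    case 2
    have "D (Main a) v \<le> Suc (D u v)"
    proof (cases "u = v")
      case True
      then show ?thesis using D_le[of a "Main a" a u] 2 D0_self[of a] by simp
    next
      case False
      then obtain a' c where "lk a' u" "lk c v" "D u v = height u + height v + D0 a' c"
        using D_attained by blast
      then show ?thesis
        using D_le[of a "Main a" c v] D0_two_step[of a u a' c] 2 by simp
    qed
    moreover have "D u v \<le> Suc (D (Main a) v)"
    proof (cases "Main a = v")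
      case True
      then show ?thesis using D_le[of a u a v] 2 D0_self[of a] by auto
    next
      case False
      then obtain c where "lk c v" "D (Main a) v = height v + D0 a c"
        using D_attained[of "Main a" v] by auto
      then show ?thesis using D_le[of a u c v] 2 by simp
    qed
    ultimately show ?thesis by blast
  qed
  then show "D (Main a) v \<le> Suc (D u v)" and "D u v \<le> Suc (D (Main a) v)" by auto
qed

lemma D_step: "E u u' \<Longrightarrow> D u v \<le> Suc (D u' v)"
proof -
  assume e: "E u u'"
  then consider a where "u = Main a" | a where "u' = Main a" by (cases u; cases u') auto
  then show ?thesis
  proof cases
    case 1
    with e show ?thesis by (auto intro: D_step_main(1))
  next
    case 2
    with E_sym[OF e] show ?thesis by (auto intro: D_step_main(2))
  qed
qed

section \<open>Neighbours closer to a given node\<close>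

lemma downhill_reaches_shortcut:
  "p \<noteq> 0 \<Longrightarrow> \<exists>q. q \<noteq> 0 \<and> \<delta> q = 0 \<and> (p - q) + (q - p) \<le> \<delta> p"
proof (induction "\<delta> p" arbitrary: p rule: less_induct)
  case less
  show ?case
  proof (cases "\<delta> p = 0")
    case False
    \<comment> \<open>One step downhill moves by one position and lowers \<open>\<delta>\<close> by
      at least one.\<close>
    then obtain r where r: "r \<noteq> 0" "r = Suc p \<or> p = Suc r" "Suc (\<delta> r) \<le> \<delta> p"
      using downhill less.prems by blast
    then obtain q where "q \<noteq> 0" "\<delta> q = 0" "(r - q) + (q - r) \<le> \<delta> r"
      using less.hyps[of r] by auto
    with r show ?thesis by (intro exI[of _ q]) auto
  qed (use less.prems in auto)
qed

text \<open>The cases follow a shortest path: from the root, take a shortcut landing within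
  \<open>\<delta> b\<close> of \<open>b\<close>; on the ray, go straight towards \<open>b\<close>,
  or downhill to a shortcut and through it to the root. Passing through a node of height 1 uses two
  edges, hence the gain of 2.\<close>

lemma D0_descent:
  assumes "a \<noteq> b"
  shows "(\<exists>a'. E (Main a) (Main a') \<and> Suc (D0 a' b) \<le> D0 a b) \<or>
    (\<exists>w a'. E (Main a) w \<and> height w = 1 \<and> lk a' w \<and> D0 a' b + 2 \<le> D0 a b)"
proof (cases "a = 0")
  case True
  then have b: "b \<noteq> 0" using assms by simp
  obtain q where q: "q \<noteq> 0" "\<delta> q = 0" "(b - q) + (q - b) \<le> \<delta> b"
    using downhill_reaches_shortcut[OF b] by blast
  then obtain n where "act n" "tgt n = q" using act_surj by blast
  with True q b show ?thesis
    by (intro disjI2 exI[of _ "Opt n"] exI[of _ q]) (auto simp: main_dist_def root_dist_def)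
next
  case False
  show ?thesis
  proof (cases "b \<noteq> 0 \<and> D0 a b = (a - b) + (b - a)")
    case True
    define a' where "a' = (if a < b then Suc a else a - 1)"
    have "a' \<noteq> 0" "a = Suc a' \<or> a' = Suc a" "Suc ((a' - b) + (b - a')) = (a - b) + (b - a)"
      using False assms True unfolding a'_def by auto
    moreover from this have "D0 a' b \<le> (a' - b) + (b - a')"
      using True unfolding main_dist_def by simp
    moreover note True
    ultimately show ?thesis using False by (intro disjI1 exI[of _ a']) simp
  next
    case via_root: False
    then have D0: "D0 a b = root_dist \<delta> a + root_dist \<delta> b"
      unfolding main_dist_def by (auto simp: min_def)
    show ?thesis
    proof (cases "\<delta> a = 0")
      case True
      then obtain n where "act n" "tgt n = a" using act_surj False by blast
      with D0 False show ?thesis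
        by (intro disjI2 exI[of _ "Opt n"] exI[of _ 0])
          (auto simp: main_dist_def[of _ _ 0] root_dist_def)
    next
      case downh: False
      then obtain a' where "a' \<noteq> 0" "a' = Suc a \<or> a = Suc a'" "Suc (\<delta> a') \<le> \<delta> a"
        using downhill False by blast
      moreover from this have "Suc (D0 a' b) \<le> D0 a b"
        using False unfolding D0 unfolding main_dist_def root_dist_def by auto
      ultimately show ?thesis using False by auto
    qed
  qed
qed

lemma D_descent:
  assumes "u \<noteq> v"
  shows "\<exists>u'. E u u' \<and> Suc (D u' v) \<le> D u v"
proof -
  obtain a b where ab: "lk a u" "lk b v" "D u v = height u + height v + D0 a b"
    using D_attained[OF assms] by blast
  show ?thesis
  proof (cases "\<exists>c. u = Main c")
    case False
    then have "E u (Main a)" "height u = 1" using ab by (cases u; auto)+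
    with ab show ?thesis using D_le[of a "Main a" b v] by auto
  next
    case True
    then have u: "u = Main a" using ab by auto
    show ?thesis
    proof (cases "a = b")
      case True
      \<comment> \<open>Since \<open>u \<noteq> v\<close>, the node \<open>v\<close> is not main,
        and it is adjacent to its link \<open>u\<close>.\<close>
      then have "E u v" using ab assms u by (cases v) auto
      moreover have "D u v \<noteq> 0" using ab assms u True by (cases v) auto
      ultimately show ?thesis using D_self[of v] by (intro exI[of _ v]) auto
    next
      case False
      from D0_descent[OF this] show ?thesis
      proof (elim disjE exE conjE)
        fix a' assume "E (Main a) (Main a')" "Suc (D0 a' b) \<le> D0 a b"
        then show ?thesis using D_le[of a' "Main a'" b v] ab u
          by (intro exI[of _ "Main a'"]) auto
      next
        fix w a' assume "E (Main a) w" "height w = 1" "lk a' w" "D0 a' b + 2 \<le> D0 a b"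
        then show ?thesis using D_le[of a' w b v] ab u
          by (intro exI[of _ w]) auto
      qed
    qed
  qed
qed

end


section \<open>Computable copies\<close>

lemma Least_singleton: "(LEAST x. x = a) = (a :: 'a :: order)"
  by (rule Least_equality) auto

lemma computable_inv:
  assumes "computable k" "bij k"
  shows "computable (inv k)"
proof -
  have iff: "k x = y \<longleftrightarrow> x = inv k y" for x y
    using bij_inv_eq_iff[OF assms(2), of x y] by blast
  then have "inv k y = (LEAST x. k x = y)" for y by (simp add: Least_singleton)
  moreover have "rec_fun Map.empty 1 (\<lambda>ys. LEAST x. k x = ys ! 0)"
  proof (rule rec_fun_Least)
    show "\<exists>x. k x = ys ! 0" for ys unfolding iff by blast
  qed (intro rec_fun_intros rec_fun_computable[OF assms(1)]; simp)
  ultimately show ?thesis unfolding computable_iff_rec_fun by simp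
qed

text \<open>
  The search for \<open>S (Suc t)\<close> need not terminate on inputs other than the values of \<open>S\<close>, so that
  the step function is partial and the closure of \<^const>\<open>rec_fun\<close> under recursion does not apply.
\<close>

lemma computable_by_search:
  assumes R: "rec_fun Map.empty 2 (\<lambda>xs. of_bool (R (xs ! 0) (xs ! 1)))"
    and S: "\<And>t s. R (S t) s \<longleftrightarrow> s = S (Suc t)"
  shows "computable S"
proof -
  have "rec_fun Map.empty 3 (\<lambda>ys. of_bool (\<not> R (ys ! 2) (ys ! 0)))"
    by (rule rec_fun_not, rule rec_fun_comp2[of _ "\<lambda>x y. of_bool (R x y)", OF R])
      (simp_all add: rec_fun_proj)
  then obtain p where p: "\<And>ys. length ys = 3 \<Longrightarrow> rec_eval Map.empty p ys (of_bool (\<not> R (ys ! 2) (ys ! 0)))"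
    unfolding rec_fun_def by blast
  then have p': "rec_eval Map.empty p [s, t, S t] (of_bool (s \<noteq> S (Suc t)))" for s t
    using p[of "[s, t, S t]"] by (simp add: S)
  obtain c where c: "rec_eval Map.empty c [] (S 0)"
    using rec_fun_const[of _ 0 "S 0"] unfolding rec_fun_def by blast
  have "rec_eval Map.empty (PrimRec c (Mu p)) [t] (S t)" for t
  proof (induction t)
    case 0
    show ?case using c by (rule rec_eval.primrec_0)
  next
    case (Suc t)
    then show ?case
    proof (rule rec_eval.primrec_Suc[OF _ rec_eval.mu])
      show "rec_eval Map.empty p [S (Suc t), t, S t] 0" using p'[of "S (Suc t)" t] by simp
      have "rec_eval Map.empty p [m, t, S t] (Suc 0)" if "m < S (Suc t)" for m
        using p'[of m t] that by simp
      then show "\<forall>m<S (Suc t). \<exists>y. rec_eval Map.empty p [m, t, S t] (Suc y)" by blast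
    qed
  qed
  then show ?thesis unfolding computable_def by blast
qed

lemma rec_fun_case_node:
  assumes "rec_fun \<psi> n F" "rec_fun \<psi> n (\<lambda>xs. A xs (F xs div 3))"
    "rec_fun \<psi> n (\<lambda>xs. B xs (F xs div 3))" "rec_fun \<psi> n (\<lambda>xs. C xs (F xs div 3))"
  shows "rec_fun \<psi> n (\<lambda>xs. case node_of (F xs) of
    Main a \<Rightarrow> A xs a | Helper t \<Rightarrow> B xs t | Opt m \<Rightarrow> C xs m)"
proof -
  have "rec_fun \<psi> n (\<lambda>xs. if F xs mod 3 = 0 then A xs (F xs div 3)
      else if F xs mod 3 = 1 then B xs (F xs div 3) else C xs (F xs div 3))"
    by (intro rec_fun_If rec_fun_eq rec_fun_mod rec_fun_const assms)
  then show ?thesis by (rule rec_fun_cong) (simp add: node_of_def)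
qed

lemma rec_fun_of_bool_case_node:
  assumes "rec_fun \<psi> n F" "rec_fun \<psi> n (\<lambda>xs. of_bool (A xs (F xs div 3)))"
    "rec_fun \<psi> n (\<lambda>xs. of_bool (B xs (F xs div 3)))"
    "rec_fun \<psi> n (\<lambda>xs. of_bool (C xs (F xs div 3)))"
  shows "rec_fun \<psi> n (\<lambda>xs. of_bool (case node_of (F xs) of
    Main a \<Rightarrow> A xs a | Helper t \<Rightarrow> B xs t | Opt m \<Rightarrow> C xs m))"
proof -
  have "rec_fun \<psi> n (\<lambda>xs. case node_of (F xs) of Main a \<Rightarrow> of_bool (A xs a)
      | Helper t \<Rightarrow> of_bool (B xs t) | Opt m \<Rightarrow> of_bool (C xs m))"
    using assms by (rule rec_fun_case_node)
  then show ?thesis by (rule rec_fun_cong) (simp split: node.split)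
qed

lemma inj_node_of: "node_of x = node_of y \<longleftrightarrow> x = y"
  by (metis code_of_node_of)

definition node_graph :: "(nat \<Rightarrow> bool) \<Rightarrow> (nat \<Rightarrow> nat) \<Rightarrow> ngraph" where
  "node_graph act tgt =
     \<lparr>verts = UNIV, adj = (\<lambda>x y. edge act tgt (node_of x) (node_of y))\<rparr>"

locale computable_shortcut_graph = shortcut_graph +
  assumes computable_act: "computable (\<lambda>n. of_bool (act n))" and computable_tgt: "computable tgt"
begin

abbreviation "G \<equiv> node_graph act tgt"

lemmas rec_fun_act = rec_fun_computable[OF computable_act]
lemmas rec_fun_tgt = rec_fun_computable[OF computable_tgt]

lemma computable_graph_G: "computable_graph G"
proof -
  \<comment> \<open>Explicit cases on both nodes fit the closure rules for
    \<open>node_of\<close>.\<close>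
  have edge: "E u v = (case u of
      Main a \<Rightarrow> (case v of Main b \<Rightarrow> a \<noteq> 0 \<and> b \<noteq> 0 \<and> (a = Suc b \<or> b = Suc a)
         | Helper t \<Rightarrow> a = Suc t \<or> a = t + 2 \<or> a = t + 3
         | Opt n \<Rightarrow> if act n then a = 0 \<or> a = tgt n else a = Suc n \<or> a = n + 3)
    | Helper t \<Rightarrow> (case v of Main a \<Rightarrow> a = Suc t \<or> a = t + 2 \<or> a = t + 3
         | Helper s \<Rightarrow> False | Opt n \<Rightarrow> False)
    | Opt n \<Rightarrow> (case v of Main a \<Rightarrow> if act n then a = 0 \<or> a = tgt n else a = Suc n \<or> a = n + 3
         | Helper s \<Rightarrow> False | Opt m \<Rightarrow> False))" for u v
    by (cases u; cases v) auto
  have "computable2 (\<lambda>x y. of_bool (E (node_of x) (node_of y)))"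
    unfolding computable2_iff_rec_fun edge
    by (intro rec_fun_of_bool_case_node rec_fun_intros rec_fun_act rec_fun_tgt; simp)
  then show ?thesis
    unfolding computable_graph_def is_graph_def node_graph_def using E_sym E_irrefl by auto
qed

text \<open>Consecutive ray positions have only helpers in common: an active \<open>Opt\<close> node
  has the root among its links, and an idle one joins positions two apart. The root and a target
  share a single node because \<open>tgt\<close> is injective on active indices.\<close>

lemma common_neighbours:
  "E w (Helper t) \<and> E w (Main (t + 2)) \<and> w \<noteq> Main (Suc t) \<longleftrightarrow> w = Main (t + 3)"
  "E w (Main (t + 2)) \<and> E w (Main (t + 3)) \<and> w \<noteq> Helper t \<longleftrightarrow> w = Helper (Suc t)"
  "act n \<Longrightarrow> E w (Main 0) \<and> E w (Main (tgt n)) \<longleftrightarrow> w = Opt n"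
  "\<not> act n \<Longrightarrow> E w (Main (Suc n)) \<and> E w (Main (n + 3)) \<and> w \<noteq> Main (n + 2) \<and> w \<noteq> Helper n
    \<longleftrightarrow> w = Opt n"
     apply (cases w; auto split: if_splits)
    apply (cases w; auto split: if_splits)
   apply (cases w; use act_tgt[of n] in \<open>auto split: if_splits dest: act_inj\<close>)
  apply (cases w; auto split: if_splits)
  done

context
  fixes H :: ngraph and k :: "nat \<Rightarrow> nat"
  assumes H: "verts H = UNIV" and k: "bij k" "\<And>x y. adj H (k x) (k y) \<longleftrightarrow> adj G x y"
begin

lemma inv_k [simp]: "inv k (k x) = x" "k (inv k y) = y"
  using k(1) by (simp_all add: bij_def surj_f_inv_f)

lemma adj_copy: "adj H x y \<longleftrightarrow> E (node_of (inv k x)) (node_of (inv k y))"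
  using k(2)[of "inv k x" "inv k y"] by (simp add: node_graph_def)

text \<open>The local criterion is applied in \<open>H\<close> itself, to the formula pulled back
  along \<open>k\<close>, which avoids transporting paths.\<close>

lemma dist_fun_copy:
  "dist_fun H = Some \<circ> (\<lambda>z. D (node_of (inv k (fst (prod_decode z))))
     (node_of (inv k (snd (prod_decode z)))))"
proof -
  let ?D = "\<lambda>x y. D (node_of (inv k x)) (node_of (inv k y))"
  have descent: "\<exists>x'. adj H x x' \<and> Suc (?D x' y) \<le> ?D x y" if "x \<noteq> y" for x y
  proof -
    have "node_of (inv k x) \<noteq> node_of (inv k y)"
      using that by (metis inj_node_of inv_k(2))
    from D_descent[OF this] obtain u
      where "E (node_of (inv k x)) u" "Suc (D u (node_of (inv k y))) \<le> ?D x y" by blast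
    then show ?thesis by (intro exI[of _ "k (code_of u)"]) (simp add: adj_copy)
  qed
  note dist = graph_dist_eqI[where D = ?D, OF H D_self _ descent]
  have "\<exists>xs. path_between H x y xs" "graph_dist H x y = ?D x y" for x y
    by (rule dist; auto simp: adj_copy intro: D_step)+
  then show ?thesis unfolding dist_fun_def by (auto simp: fun_eq_iff split: prod.splits)
qed

text \<open>
  The isomorphism is computed along the ray from the images of the root and of three further
  nodes: each further node is the only new common neighbour of two nodes already reached.
\<close>

lemma computable_copy:
  assumes "computable2 (\<lambda>x y. of_bool (adj H x y))"
  shows "computable k"
proof -
  define K where "K u = k (code_of u)" for u
  have K_eq: "x = K u \<longleftrightarrow> node_of (inv k x) = u" for x u
    unfolding K_def by (metis code_of_node_of inv_k node_of_code_of)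
  have inv_K: "node_of (inv k (K u)) = u" for u
    using K_eq by blast
  \<comment> \<open>A state holds the images of two consecutive ray nodes and of their helper.
    \<open>S 0\<close> and the image of the root are the finite information built into the
    program.\<close>
  define S where "S t = prod_encode (K (Main (Suc t)),
    prod_encode (K (Main (t + 2)), K (Helper t)))" for t
  \<comment> \<open>Moving one step along the ray: \<open>c\<close> and \<open>e1\<close> identify
    the next ray node, and the last two ray nodes then identify the next helper.\<close>
  define R where "R s s' \<longleftrightarrow>
     (let e0 = fst (prod_decode s); e1 = fst (prod_decode (snd (prod_decode s)));
          c = snd (prod_decode (snd (prod_decode s)));
          e0' = fst (prod_decode s'); e1' = fst (prod_decode (snd (prod_decode s')));
          c' = snd (prod_decode (snd (prod_decode s')))
      in e0' = e1 \<and> (adj H e1' c \<and> adj H e1' e1 \<and> e1' \<noteq> e0) \<and>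
         (adj H c' e1 \<and> adj H c' e1' \<and> c' \<noteq> c))" for s s'
  have S_iff: "R (S t) s \<longleftrightarrow> s = S (Suc t)" for t s
  proof -
    obtain e0 e1 c where s: "s = prod_encode (e0, prod_encode (e1, c))"
      by (metis prod_decode_inverse surj_pair)
    have "adj H e1 (K (Helper t)) \<and> adj H e1 (K (Main (t + 2))) \<and> e1 \<noteq> K (Main (Suc t))
        \<longleftrightarrow> e1 = K (Main (t + 3))"
      unfolding adj_copy inv_K K_eq by (rule common_neighbours)
    moreover have "adj H c (K (Main (t + 2))) \<and> adj H c (K (Main (t + 3))) \<and> c \<noteq> K (Helper t)
        \<longleftrightarrow> c = K (Helper (Suc t))"
      unfolding adj_copy inv_K K_eq by (rule common_neighbours)
    ultimately show ?thesis
      unfolding R_def S_def s Let_def prod_encode_inverse fst_conv snd_conv prod_encode_eq prod.inject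
      by (auto simp: eval_nat_numeral)
  qed
  note adj_H = rec_fun_computable2[OF assms]
  have S: "computable S"
    by (rule computable_by_search[of R S, OF _ S_iff], unfold R_def Let_def)
      (intro rec_fun_intros adj_H; simp)
  define M where "M a = (if a = 0 then K (Main 0) else fst (prod_decode (S (a - 1))))" for a
  have M: "M a = K (Main a)" for a by (simp add: M_def S_def)
  have M_rec: "rec_fun Map.empty n (\<lambda>xs. M (F xs))" if "rec_fun Map.empty n F" for n F
    unfolding M_def by (intro rec_fun_intros rec_fun_computable[OF S] that)
  define C where "C t = snd (prod_decode (snd (prod_decode (S t))))" for t
  have C: "C t = K (Helper t)" for t by (simp add: C_def S_def)
  have C_rec: "rec_fun Map.empty n (\<lambda>xs. C (F xs))" if "rec_fun Map.empty n F" for n F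
    unfolding C_def by (intro rec_fun_intros rec_fun_computable[OF S] that)
  \<comment> \<open>As \<open>act\<close> is decidable, it is known which pair of main nodes
    identifies \<open>Opt n\<close>. An idle node shares its pair with \<open>Main (n + 2)\<close>
    and \<open>Helper n\<close>, which are excluded.\<close>
  define Q where "Q n w \<longleftrightarrow> (if act n then adj H w (M 0) \<and> adj H w (M (tgt n))
     else adj H w (M (Suc n)) \<and> adj H w (M (n + 3)) \<and> w \<noteq> M (n + 2) \<and> w \<noteq> C n)" for n w
  have Q: "Q n w \<longleftrightarrow> w = K (Opt n)" for n w
  proof (cases "act n")
    case True
    then show ?thesis
      unfolding Q_def M adj_copy inv_K K_eq by (simp only: if_True common_neighbours)
  next
    case False
    then show ?thesis
      unfolding Q_def M C adj_copy inv_K K_eq by (simp only: if_False common_neighbours not_False_eq_True)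
  qed
  have k_eq: "k v = (case node_of v of Main a \<Rightarrow> M a | Helper t \<Rightarrow> C t | Opt n \<Rightarrow> LEAST w. Q n w)"
    for v
  proof -
    have "k v = K (node_of v)" by (simp add: K_def)
    then show ?thesis by (simp add: M C Q Least_singleton split: node.split)
  qed
  have Q_rec: "rec_fun Map.empty 1 (\<lambda>xs. LEAST w. Q (xs ! 0 div 3) w)"
    by (rule rec_fun_Least, unfold Q_def[abs_def])
      (intro rec_fun_intros rec_fun_act rec_fun_tgt adj_H M_rec C_rec; simp | use Q Q_def in blast)+
  show "computable k"
    unfolding computable_iff_rec_fun k_eq
    by (intro rec_fun_case_node rec_fun_intros M_rec C_rec Q_rec; simp)
qed

end

lemma computable_copyE:
  assumes "computable_graph H" "graph_isomorphic H G"
  obtains k where "bij k" "computable k" "computable (inv k)"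
    "dist_fun H = Some \<circ> (\<lambda>z. D (node_of (inv k (fst (prod_decode z))))
      (node_of (inv k (snd (prod_decode z)))))"
proof -
  have verts_G: "verts G = UNIV" by (simp add: node_graph_def)
  with assms(2) obtain h where h: "bij_betw h (verts H) UNIV"
    "\<And>x y. x \<in> verts H \<Longrightarrow> y \<in> verts H \<Longrightarrow> adj H x y \<longleftrightarrow> adj G (h x) (h y)"
    unfolding graph_isomorphic_def verts_G by blast
  \<comment> \<open>This rules out copies whose domain is a finite initial segment.\<close>
  have "infinite (verts H)"
    using bij_betw_finite[OF h(1)] by simp
  then have H: "verts H = UNIV"
    using assms(1) unfolding computable_graph_def by (metis finite_lessThan)
  define k where "k = inv h"
  have k: "bij k" "\<And>x y. adj H (k x) (k y) \<longleftrightarrow> adj G x y"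
    using h(1) h(2)[of "inv h x" "inv h y" for x y] unfolding H k_def
    by (simp_all add: bij_imp_bij_inv bij_is_surj surj_f_inv_f)
  have "computable k"
    using assms(1) computable_copy[OF H k] unfolding computable_graph_def by blast
  then show thesis
    using that[OF k(1)] computable_inv[OF _ k(1)] dist_fun_copy[OF H k] by blast
qed


section \<open>Computing the distance formula and comparing copies\<close>

lemma rec_fun_link:
  assumes "rec_fun \<psi> n F"
  shows "rec_fun \<psi> n (\<lambda>xs. link1 act tgt (node_of (F xs)))"
    and "rec_fun \<psi> n (\<lambda>xs. link2 act tgt (node_of (F xs)))"
    and "rec_fun \<psi> n (\<lambda>xs. link3 act tgt (node_of (F xs)))"
    and "rec_fun \<psi> n (\<lambda>xs. height (node_of (F xs)))"
proof -
  have cases: "link1 act tgt u = (case u of Main a \<Rightarrow> a | Helper t \<Rightarrow> Suc t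
      | Opt n \<Rightarrow> if act n then 0 else Suc n)"
    "link2 act tgt u = (case u of Main a \<Rightarrow> a | Helper t \<Rightarrow> t + 2
      | Opt n \<Rightarrow> if act n then tgt n else n + 3)"
    "link3 act tgt u = (case u of Main a \<Rightarrow> a | Helper t \<Rightarrow> t + 3
      | Opt n \<Rightarrow> if act n then tgt n else n + 3)"
    "height u = (case u of Main a \<Rightarrow> 0 | Helper t \<Rightarrow> 1 | Opt n \<Rightarrow> 1)" for u
    by (cases u; simp)+
  show "rec_fun \<psi> n (\<lambda>xs. link1 act tgt (node_of (F xs)))"
    and "rec_fun \<psi> n (\<lambda>xs. link2 act tgt (node_of (F xs)))"
    and "rec_fun \<psi> n (\<lambda>xs. link3 act tgt (node_of (F xs)))"
    and "rec_fun \<psi> n (\<lambda>xs. height (node_of (F xs)))"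
    unfolding cases
    by (intro rec_fun_case_node rec_fun_intros rec_fun_act rec_fun_tgt assms)+
qed

text \<open>The ray functions may depend on all of \<open>xs\<close>, so that they can incorporate
  values of \<open>f\<close> supplied by an oracle or a table.\<close>

lemma rec_fun_node_dist:
  assumes "rec_fun \<psi> n F" "rec_fun \<psi> n F'"
    and "\<And>A. rec_fun \<psi> n A \<Longrightarrow> rec_fun \<psi> n (\<lambda>xs. d xs (A xs))"
    and "\<And>A. rec_fun \<psi> n A \<Longrightarrow> rec_fun \<psi> n (\<lambda>xs. d' xs (A xs))"
  shows "rec_fun \<psi> n (\<lambda>xs. node_dist act tgt (d xs) (d' xs) (node_of (F xs)) (node_of (F' xs)))"
  unfolding node_dist_def min_link_def main_dist_def root_dist_def inj_node_of
  by (intro rec_fun_arith rec_fun_link assms)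

text \<open>The computable bijection \<open>l \<circ> inv k\<close> between the copies, applied to
  both components of a pair, is the reduction.\<close>

lemma one_reducible_copies:
  assumes "bij k" "computable (inv k)" "bij l" "computable l"
    and "\<phi> = Some \<circ> (\<lambda>z. d (inv k (fst (prod_decode z))) (inv k (snd (prod_decode z))))"
    and "\<psi> = Some \<circ> (\<lambda>z. d (inv l (fst (prod_decode z))) (inv l (snd (prod_decode z))))"
  shows "one_reducible \<phi> \<psi>"
proof -
  define h where "h z = prod_encode (l (inv k (fst (prod_decode z))), l (inv k (snd (prod_decode z))))"
    for z
  have inj: "inj l" "inj (inv k)"
    using assms(1,3) by (auto intro: bij_is_inj bij_imp_bij_inv)
  have "computable h"
    unfolding computable_iff_rec_fun h_def
    by (intro rec_fun_intros rec_fun_computable[OF assms(2)] rec_fun_computable[OF assms(4)]) simp_all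
  moreover have "inj h"
  proof (rule injI)
    fix x y assume "h x = h y"
    then have "prod_decode x = prod_decode y"
      using inj unfolding h_def by (simp add: prod_encode_eq inj_eq prod_eq_iff)
    then show "x = y" by (simp add: prod_decode_eq)
  qed
  moreover have "\<phi> = \<psi> \<circ> h"
    unfolding assms(5,6) h_def by (simp add: fun_eq_iff inj)
  ultimately show ?thesis unfolding one_reducible_def by blast
qed

end

text \<open>The formula evaluates its ray functions only at links, and \<open>root_dist\<close> is 0
  at the root whatever they are.\<close>

lemma node_dist_cong:
  assumes "\<And>p. p \<noteq> 0 \<Longrightarrow> linked act tgt p u \<Longrightarrow> d1 p = d2 p"
    and "\<And>p. p \<noteq> 0 \<Longrightarrow> linked act tgt p v \<Longrightarrow> d1' p = d2' p"
  shows "node_dist act tgt d1 d1' u v = node_dist act tgt d2 d2' u v"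
proof -
  have "main_dist d1 d1' a b = main_dist d2 d2' a b" if "linked act tgt a u" "linked act tgt b v" for a b
    using assms that unfolding main_dist_def root_dist_def by simp
  then show ?thesis unfolding node_dist_def min_link_def by (simp add: linked_def)
qed


section \<open>Reading values from restriction codes\<close>

text \<open>The code of a finite set is a bit mask, here of the pairs in a graph. The alternative
  \<open>y = c\<close> ends the search on every input, keeping \<open>lookup\<close> total.\<close>

definition lookup :: "nat \<Rightarrow> nat \<Rightarrow> nat" where
  "lookup a c = (LEAST y. y = c \<or> c div 2 ^ prod_encode (a, y) mod 2 = 1)"

lemma lookup_restriction_code:
  assumes "finite A" "a \<in> A"
  shows "lookup a (restriction_code \<beta> A) = \<beta> a"
proof -
  define B where "B = (\<lambda>z. prod_encode (z, \<beta> z)) ` A"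
  have B: "finite B" "prod_encode (a, \<beta> a) \<in> B" using assms unfolding B_def by auto
  have bit: "set_encode B div 2 ^ prod_encode (a, y) mod 2 = 1 \<longleftrightarrow> y = \<beta> a" for y
  proof -
    have "set_encode B div 2 ^ prod_encode (a, y) mod 2 = 1 \<longleftrightarrow>
        prod_encode (a, y) \<in> set_decode (set_encode B)"
      unfolding set_decode_def by (simp add: odd_iff_mod_2_eq_one)
    also have "\<dots> \<longleftrightarrow> y = \<beta> a"
      using B assms(2) unfolding B_def by (auto simp: prod_encode_eq)
    finally show ?thesis .
  qed
  \<comment> \<open>The value lies strictly below the code, so the alternative \<open>y = c\<close>
    does not stop the search early.\<close>
  have "\<beta> a \<le> prod_encode (a, \<beta> a)" by (rule le_prod_encode_2)
  also have "\<dots> < 2 ^ prod_encode (a, \<beta> a)" by (rule less_exp)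
  also have "\<dots> \<le> set_encode B"
    unfolding set_encode_def using B by (intro member_le_sum) auto
  finally have "\<beta> a < set_encode B" .
  then show ?thesis
    unfolding lookup_def restriction_code_def B_def[symmetric] bit
    by (intro Least_equality) auto
qed

lemma rec_fun_lookup:
  "rec_fun \<psi> n F \<Longrightarrow> rec_fun \<psi> n C \<Longrightarrow> rec_fun \<psi> n (\<lambda>xs. lookup (F xs) (C xs))"
proof -
  have "rec_fun \<psi> 2 (\<lambda>xs. lookup (xs ! 0) (xs ! 1))"
    unfolding lookup_def by (rule rec_fun_Least, (intro rec_fun_intros; simp), blast)
  then show "rec_fun \<psi> n F \<Longrightarrow> rec_fun \<psi> n C \<Longrightarrow> rec_fun \<psi> n (\<lambda>xs. lookup (F xs) (C xs))"
    by (rule rec_fun_comp2)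
qed


section \<open>Coding an approximable function by distances\<close>

text \<open>
  The positions \<open>1, 2, \<dots>\<close> of the ray are cut into blocks, block \<open>x\<close> being the interval of radius
  \<open>g x 0\<close> around \<open>center x\<close>. A position at distance \<open>i\<close> from the center gets joined to the root
  as soon as \<open>g x s \<le> i\<close>; in the limit these are the positions with \<open>f x \<le> i\<close>.
\<close>

locale upper_approximation =
  fixes f :: "nat \<Rightarrow> nat" and g :: "nat \<Rightarrow> nat \<Rightarrow> nat"
  assumes computable2_g: "computable2 g"
    and g_antimono: "s \<le> t \<Longrightarrow> g x t \<le> g x s"
    and f_le_g: "f x \<le> g x s"
    and g_reaches_f: "\<exists>s. g x s = f x"
begin

primrec start :: "nat \<Rightarrow> nat" where
  "start 0 = 1"
| "start (Suc x) = start x + (2 * g x 0 + 1)"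

definition block :: "nat \<Rightarrow> nat" where
  "block p = (LEAST x. p < start (Suc x))"

definition center :: "nat \<Rightarrow> nat" where
  "center x = start x + g x 0"

definition off :: "nat \<Rightarrow> nat \<Rightarrow> nat" where
  "off x p = (p - center x) + (center x - p)"

text \<open>Truncated subtraction gives 0 at the positions joined in the limit. They include both
  ends of every block, as \<open>f x \<le> g x 0\<close>.\<close>

definition \<delta> :: "nat \<Rightarrow> nat" where
  "\<delta> p = f (block p) - off (block p) p"

definition tgt :: "nat \<Rightarrow> nat" where
  "tgt n = fst (prod_decode n)"

definition joined :: "nat \<Rightarrow> nat \<Rightarrow> bool" where
  "joined p s \<longleftrightarrow> g (block p) s \<le> off (block p) p"

text \<open>\<open>n\<close> codes a position and a stage, and is active if this is the first stage
  at which the position is joined. So each joined position has exactly one active index.\<close>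

definition act :: "nat \<Rightarrow> bool" where
  "act n \<longleftrightarrow> tgt n \<noteq> 0 \<and> joined (tgt n) (snd (prod_decode n)) \<and>
     (snd (prod_decode n) = 0 \<or> \<not> joined (tgt n) (snd (prod_decode n) - 1))"

section \<open>Geometry of the blocks\<close>

lemma start_less: "x < y \<Longrightarrow> start x < start y"
  by (rule lift_Suc_mono_less[of start]) auto

lemma less_start: "x < start x"
  by (induction x) auto

lemma start_less_iff: "start x < start y \<longleftrightarrow> x < y"
  using start_less by (metis linorder_neqE_nat order_less_asym order_less_irrefl)

lemma block_bounds:
  assumes "p \<noteq> 0"
  shows "start (block p) \<le> p" "p < start (Suc (block p))"
proof -
  show "p < start (Suc (block p))"
    unfolding block_def by (rule LeastI[of _ p]) (use less_start[of p] in simp)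
  show "start (block p) \<le> p"
  proof (cases "block p")
    case (Suc x)
    then have "\<not> p < start (Suc x)" unfolding block_def by (intro not_less_Least) simp
    with Suc show ?thesis by simp
  qed (use assms in simp)
qed

lemma block_eqI:
  assumes "start x \<le> p" "p < start (Suc x)"
  shows "block p = x"
proof -
  have "p \<noteq> 0" using assms(1) less_start[of x] by linarith
  note b = block_bounds[OF this]
  have "start x < start (Suc (block p))" "start (block p) < start (Suc x)"
    using b assms by linarith+
  then show ?thesis unfolding start_less_iff by simp
qed

text \<open>If \<open>p\<close> lies in the block next to that of \<open>q\<close>, the two meet at
  a block boundary. There \<open>p\<close> has distance at least \<open>g x 0 \<ge> f x\<close> from
  either center, so both sides are 0.\<close>

lemma \<delta>_near:
  assumes p: "p \<noteq> 0" and q: "q \<noteq> 0" and near: "p \<le> Suc q" "q \<le> Suc p"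
  shows "\<delta> p = f (block q) - off (block q) p"
proof -
  let ?x = "block q"
  note bq = block_bounds[OF q] and bp = block_bounds[OF p]
  consider "block p = ?x" | "p < start ?x" | "start (Suc ?x) \<le> p"
    using block_eqI[of ?x p] by linarith
  then show ?thesis
  proof cases
    case 2
    then have eq: "Suc p = start ?x" using bq near by linarith
    then have "start (block p) < start ?x" "start ?x \<le> start (Suc (block p))"
      using bp by linarith+
    then have x: "?x = Suc (block p)"
      using start_less_iff[of "Suc (block p)" ?x] start_less_iff[of "block p" ?x] by linarith
    have "f (block p) \<le> off (block p) p"
      using f_le_g[of "block p" 0] eq unfolding x off_def center_def by simp
    moreover have "f ?x \<le> off ?x p"
      using f_le_g[of ?x 0] eq unfolding off_def center_def by simp
    ultimately show ?thesis unfolding \<delta>_def by simp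
  next
    case 3
    then have eq: "p = start (Suc ?x)" using bq near by linarith
    then have y: "block p = Suc ?x" by (intro block_eqI) auto
    have "f (block p) \<le> off (block p) p"
      using f_le_g[of "Suc ?x" 0] eq unfolding y off_def center_def by simp
    moreover have "f ?x \<le> off ?x p"
      using f_le_g[of ?x 0] eq unfolding off_def center_def by simp
    ultimately show ?thesis unfolding \<delta>_def by simp
  qed (simp add: \<delta>_def)
qed

lemma center_nonzero: "center x \<noteq> 0"
  using less_start[of x] unfolding center_def by linarith

lemma \<delta>_center: "\<delta> (center x) = f x"
proof -
  have "block (center x) = x" by (rule block_eqI) (simp_all add: center_def)
  then show ?thesis by (simp add: \<delta>_def off_def)
qed

section \<open>Computability of the construction\<close>

lemma rec_fun_start: "rec_fun \<psi> n F \<Longrightarrow> rec_fun \<psi> n (\<lambda>xs. start (F xs))"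
proof -
  have "start x = rec_nat 1 (\<lambda>x y. y + (2 * g x 0 + 1)) x" for x by (induction x) auto
  then show "rec_fun \<psi> n F \<Longrightarrow> rec_fun \<psi> n (\<lambda>xs. start (F xs))"
    by (simp only:) (intro rec_fun_rec_nat rec_fun_intros rec_fun_computable2[OF computable2_g]; simp)
qed

lemma rec_fun_block: "rec_fun \<psi> n F \<Longrightarrow> rec_fun \<psi> n (\<lambda>xs. block (F xs))"
proof (rule rec_fun_comp1[of _ block])
  show "rec_fun \<psi> 1 (\<lambda>ys. block (ys ! 0))"
    unfolding block_def
  proof (rule rec_fun_Least)
    show "\<exists>x. ys ! 0 < start (Suc x)" for ys :: "nat list"
      using less_start[of "ys ! 0"] by (intro exI[of _ "ys ! 0"]) simp
  qed (intro rec_fun_intros rec_fun_start; simp)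
qed

lemma rec_fun_center: "rec_fun \<psi> n F \<Longrightarrow> rec_fun \<psi> n (\<lambda>xs. center (F xs))"
  unfolding center_def by (intro rec_fun_intros rec_fun_start rec_fun_computable2[OF computable2_g])

lemma rec_fun_off:
  "rec_fun \<psi> n F \<Longrightarrow> rec_fun \<psi> n F' \<Longrightarrow> rec_fun \<psi> n (\<lambda>xs. off (F xs) (F' xs))"
  unfolding off_def by (intro rec_fun_intros rec_fun_center)

sublocale computable_shortcut_graph act tgt \<delta>
proof
  have \<delta>: "\<delta> p = f (block p) - off (block p) p" for p by (simp add: \<delta>_def)
  fix p :: nat assume p: "p \<noteq> 0"
  \<comment> \<open>With the block of \<open>p\<close> kept fixed, the two values differ only
    through \<open>off\<close>, even across a boundary.\<close>
  have Suc: "\<delta> (Suc p) = f (block p) - off (block p) (Suc p)"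
    by (rule \<delta>_near) (use p in auto)
  show "\<delta> p \<le> Suc (\<delta> (Suc p))" "\<delta> (Suc p) \<le> Suc (\<delta> p)"
    unfolding \<delta>[of p] Suc by (auto simp: off_def)
  show "\<exists>q. q \<noteq> 0 \<and> (q = Suc p \<or> p = Suc q) \<and> Suc (\<delta> q) \<le> \<delta> p" if pos: "\<delta> p \<noteq> 0"
  \<comment> \<open>Moving away from the center leads downhill.\<close>
  proof (cases "p < center (block p)")
    case False
    with pos show ?thesis
      unfolding \<delta>[of p] by (intro exI[of _ "Suc p"]) (auto simp: Suc off_def)
  next
    case True
    \<comment> \<open>A position with positive \<open>\<delta>\<close> is not an end of its block,
      so \<open>p - 1\<close> stays on the ray.\<close>
    have lt: "off (block p) p < g (block p) 0"
      using pos f_le_g[of "block p" 0] unfolding \<delta>_def by linarith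
    then have "start (block p) < p" using True unfolding off_def center_def by linarith
    then have q: "p - 1 \<noteq> 0" using less_start[of "block p"] by linarith
    then have "\<delta> (p - 1) = f (block p) - off (block p) (p - 1)"
      by (intro \<delta>_near) (use p in auto)
    with True pos q show ?thesis
      unfolding \<delta>[of p] by (intro exI[of _ "p - 1"]) (auto simp: off_def)
  qed
  show "\<exists>n. act n \<and> tgt n = p" if zero: "\<delta> p = 0"
  proof -
    define s where "s = (LEAST s. joined p s)"
    have "\<exists>s. joined p s"
      using g_reaches_f[of "block p"] zero unfolding joined_def \<delta>_def diff_is_0_eq by metis
    then have "joined p s" unfolding s_def by (rule LeastI_ex)
    moreover have "s = 0 \<or> \<not> joined p (s - 1)"
      using not_less_Least[of "s - 1" "joined p"] unfolding s_def[symmetric] by linarith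
    ultimately show ?thesis
      using p by (intro exI[of _ "prod_encode (p, s)"]) (simp add: act_def tgt_def)
  qed
next
  fix n assume "act n"
  then show "tgt n \<noteq> 0 \<and> \<delta> (tgt n) = 0"
    using f_le_g order_trans unfolding act_def joined_def \<delta>_def by fastforce
next
  have le: "snd (prod_decode n) \<le> snd (prod_decode m)"
    if "act m" "act n" "tgt m = tgt n" for m n
  proof (rule ccontr)
    let ?s = "snd (prod_decode m)" and ?t = "snd (prod_decode n)"
    assume "\<not> ?t \<le> ?s"
    \<comment> \<open>The position is joined at stage \<open>?s\<close>, hence by monotonicity at
      \<open>?t - 1\<close>, against the minimality of the stage in \<open>act n\<close>.\<close>
    then have "?s \<le> ?t - 1" "?t \<noteq> 0" by auto
    then show False
      using that g_antimono[OF \<open>?s \<le> ?t - 1\<close>] order_trans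
      unfolding act_def joined_def by metis
  qed
  fix m n assume "act m" "act n" "tgt m = tgt n"
  then have "prod_decode m = prod_decode n"
    using le[of m n] le[of n m] unfolding tgt_def by (simp add: prod_eq_iff)
  then show "m = n" by (simp add: prod_decode_eq)
next
  show tgt: "computable tgt"
    unfolding computable_iff_rec_fun tgt_def by (intro rec_fun_intros) simp
  show "computable (\<lambda>n. of_bool (act n))"
    unfolding computable_iff_rec_fun act_def joined_def
    by (intro rec_fun_intros rec_fun_computable[OF tgt] rec_fun_block rec_fun_off
        rec_fun_computable2[OF computable2_g]; simp)
qed

text \<open>
  All positions linked to a node are at most one step away from a single position, hence their
  values of \<open>\<delta>\<close> are determined by one value of \<open>f\<close>.
\<close>

definition node_block :: "node \<Rightarrow> nat" where
  "node_block u = block (case u of Main a \<Rightarrow> a | Helper t \<Rightarrow> t + 2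
     | Opt n \<Rightarrow> if act n then tgt n else n + 2)"

lemma \<delta>_node_block:
  assumes "lk p u" "p \<noteq> 0"
  shows "\<delta> p = f (node_block u) - off (node_block u) p"
  unfolding node_block_def
  by (rule \<delta>_near; cases u) (use assms in \<open>auto split: if_splits\<close>)

text \<open>The arguments \<open>y\<close> and \<open>y'\<close> stand for the values of
  \<open>f\<close> at the two node blocks, so that an oracle or a truth table can provide
  them.\<close>

definition local_dist :: "nat \<Rightarrow> nat \<Rightarrow> node \<Rightarrow> node \<Rightarrow> nat" where
  "local_dist y y' u v = node_dist act tgt
     (\<lambda>p. y - off (node_block u) p) (\<lambda>p. y' - off (node_block v) p) u v"

lemma D_eq_local_dist: "D u v = local_dist (f (node_block u)) (f (node_block v)) u v"
  unfolding local_dist_def by (rule node_dist_cong) (simp_all add: \<delta>_node_block)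

lemma rec_fun_node_block: "rec_fun \<psi> n F \<Longrightarrow> rec_fun \<psi> n (\<lambda>xs. node_block (node_of (F xs)))"
  unfolding node_block_def
  by (intro rec_fun_block rec_fun_case_node rec_fun_intros rec_fun_act rec_fun_tgt)

lemma rec_fun_local_dist:
  assumes "rec_fun \<psi> n Y" "rec_fun \<psi> n Y'" "rec_fun \<psi> n F" "rec_fun \<psi> n F'"
  shows "rec_fun \<psi> n (\<lambda>xs. local_dist (Y xs) (Y' xs) (node_of (F xs)) (node_of (F' xs)))"
  unfolding local_dist_def
  by (intro rec_fun_node_dist rec_fun_diff rec_fun_off rec_fun_node_block assms)

text \<open>From the center of block \<open>x\<close>, the root is reached by \<open>f x\<close>
  steps on the ray and a shortcut of length 2.\<close>

lemma f_eq_D: "f x = D (Main 0) (Main (center x)) - 2"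
  using center_nonzero[of x]
  by (simp add: node_dist_def min_link_def main_dist_def root_dist_def \<delta>_center)

section \<open>Reductions between \<open>f\<close> and the distance function of a copy\<close>

context
  fixes k :: "nat \<Rightarrow> nat" and dk :: "nat \<Rightarrow> nat"
  assumes k: "bij k" "computable k" "computable (inv k)"
    and dk: "dk = (\<lambda>z. D (node_of (inv k (fst (prod_decode z))))
      (node_of (inv k (snd (prod_decode z)))))"
begin

definition left :: "nat \<Rightarrow> nat" where "left z = inv k (fst (prod_decode z))"
definition right :: "nat \<Rightarrow> nat" where "right z = inv k (snd (prod_decode z))"

definition witness :: "nat \<Rightarrow> nat" where
  "witness x = prod_encode (k (code_of (Main 0)), k (code_of (Main (center x))))"

lemma f_eq_copy: "f x = dk (witness x) - 2"
  unfolding dk witness_def f_eq_D[of x] using k(1)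
  by (simp only: prod_encode_inverse fst_conv snd_conv inv_f_f[OF bij_is_inj] node_of_code_of)

lemma copy_eq_local_dist:
  "dk z = local_dist (f (node_block (node_of (left z)))) (f (node_block (node_of (right z))))
     (node_of (left z)) (node_of (right z))"
  unfolding dk D_eq_local_dist left_def right_def ..

lemma rec_fun_witness: "rec_fun \<psi> n F \<Longrightarrow> rec_fun \<psi> n (\<lambda>xs. witness (F xs))"
  unfolding witness_def code_of.simps
  by (intro rec_fun_intros rec_fun_computable[OF k(2)] rec_fun_center)

lemma rec_fun_left: "rec_fun \<psi> n F \<Longrightarrow> rec_fun \<psi> n (\<lambda>xs. left (F xs))"
  unfolding left_def by (intro rec_fun_intros rec_fun_computable[OF k(3)])

lemma rec_fun_right: "rec_fun \<psi> n F \<Longrightarrow> rec_fun \<psi> n (\<lambda>xs. right (F xs))"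
  unfolding right_def by (intro rec_fun_intros rec_fun_computable[OF k(3)])

lemma copy_turing_equivalent: "turing_equivalent (Some \<circ> dk) (Some \<circ> f)"
  unfolding turing_equivalent_def
proof
  show "turing_reducible (Some \<circ> dk) (Some \<circ> f)"
    by (rule turing_reducibleI, unfold copy_eq_local_dist)
      (intro rec_fun_local_dist rec_fun_oracle rec_fun_node_block rec_fun_left rec_fun_right
        rec_fun_proj; simp)
  show "turing_reducible (Some \<circ> f) (Some \<circ> dk)"
    by (rule turing_reducibleI, unfold f_eq_copy)
      (intro rec_fun_diff rec_fun_oracle rec_fun_witness rec_fun_const rec_fun_proj; simp)
qed

lemma copy_btt_reducible: "btt_reducible 2 (Some \<circ> dk) (Some \<circ> f)"
proof -
  define a where "a z = node_block (node_of (left z))" for z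
  define b where "b z = node_block (node_of (right z))" for z
  \<comment> \<open>Equal blocks are treated separately: \<open>2 ^ a + 2 ^ a = 2 ^ (a + 1)\<close>
    would code the wrong set.\<close>
  define p where "p z = (if a z = b z then 2 ^ a z else 2 ^ a z + 2 ^ b z :: nat)" for z
  define q where "q z c = local_dist (lookup (a z) c) (lookup (b z) c)
    (node_of (left z)) (node_of (right z))" for z c
  have "p z = set_encode {a z, b z}" for z
    by (simp add: p_def set_encode_def)
  then have p: "set_decode (p z) = {a z, b z}" for z by simp
  note rec_fun_ab = rec_fun_node_block rec_fun_left rec_fun_right
  have "computable p"
    unfolding computable_iff_rec_fun p_def a_def b_def
    by (intro rec_fun_intros rec_fun_ab; simp)
  moreover have "computable2 q"
    unfolding computable2_iff_rec_fun q_def a_def b_def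
    by (intro rec_fun_local_dist rec_fun_lookup rec_fun_ab rec_fun_proj; simp)
  moreover have "dk z = q z (restriction_code f (set_decode (p z)))" for z
    unfolding p q_def by (simp add: lookup_restriction_code copy_eq_local_dist a_def b_def)
  moreover have "card (set_decode (p z)) \<le> 2" for z
    unfolding p by (simp add: card_insert_if)
  ultimately show ?thesis unfolding btt_reducible_def by blast
qed

lemma btt_reducible_copy: "btt_reducible 1 (Some \<circ> f) (Some \<circ> dk)"
proof -
  define p where "p x = (2 ^ witness x :: nat)" for x
  define q where "q x c = lookup (witness x) c - 2" for x c
  have "p x = set_encode {witness x}" for x by (simp add: p_def set_encode_def)
  then have p: "set_decode (p x) = {witness x}" for x
    by (simp only: set_encode_inverse finite.intros)
  have "computable p"
    unfolding computable_iff_rec_fun p_def by (intro rec_fun_intros rec_fun_witness; simp)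
  moreover have "computable2 q"
    unfolding computable2_iff_rec_fun q_def
    by (intro rec_fun_intros rec_fun_lookup rec_fun_witness; simp)
  moreover have "f x = q x (restriction_code dk (set_decode (p x)))" for x
    unfolding p q_def by (simp add: lookup_restriction_code f_eq_copy)
  moreover have "card (set_decode (p x)) \<le> 1" for x unfolding p by simp
  ultimately show ?thesis unfolding btt_reducible_def by blast
qed

end

end

section \<open>From an approximation to the degree spectrum\<close>

lemma approximable_from_above_imp_upper_approximation:
  assumes "approximable_from_above f"
  obtains g where "upper_approximation f g"
proof -
  from assms obtain g where g: "computable2 g" "\<And>x s. g x (Suc s) \<le> g x s"
    "\<And>x. (\<lambda>s. g x s) \<longlonglongrightarrow> f x"
    unfolding approximable_from_above_def by blast
  have anti: "g x t \<le> g x s" if "s \<le> t" for x s t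
    using g(2) that by (rule lift_Suc_antimono_le)
  have lim: "\<exists>N. \<forall>s\<ge>N. g x s = f x" for x
    using g(3)[of x] unfolding tendsto_discrete eventually_sequentially .
  have "f x \<le> g x s" for x s
  proof -
    obtain N where "\<forall>s\<ge>N. g x s = f x" using lim by blast
    then have "g x (max s N) = f x" by simp
    then show ?thesis using anti[of s "max s N" x] by simp
  qed
  then have "upper_approximation f g"
    using g(1) anti lim by unfold_locales blast+
  then show thesis by (rule that)
qed

theorem theorem4p4:
  fixes f :: "nat \<Rightarrow> nat"
  assumes "approximable_from_above f"
  shows "\<exists>G. computable_graph G \<and> connected_graph G \<and>
           dist_spectrum G = {turing_degree (Some \<circ> f)} \<and>
           (\<forall>H. computable_graph H \<and> graph_isomorphic H G \<longrightarrow>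
              one_equivalent (dist_fun H) (dist_fun G) \<and>
              btt_reducible 2 (dist_fun G) (Some \<circ> f) \<and>
              btt_reducible 1 (Some \<circ> f) (dist_fun H))"
proof -
  obtain g where "upper_approximation f g"
    using assms by (rule approximable_from_above_imp_upper_approximation)
  then interpret upper_approximation f g .
  have iso: "graph_isomorphic G G"
    unfolding graph_isomorphic_def by (intro exI[of _ id]) (simp add: bij_betw_def)
  \<comment> \<open>\<open>G\<close> is a computable copy of itself, so its distance function has
    the same representation.\<close>
  obtain l where l: "bij l" "computable l" "computable (inv l)"
    "dist_fun G = Some \<circ> (\<lambda>z. D (node_of (inv l (fst (prod_decode z))))
      (node_of (inv l (snd (prod_decode z)))))"
    using computable_graph_G iso by (rule computable_copyE)
  have copy: "turing_degree (dist_fun H) = turing_degree (Some \<circ> f) \<and>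
      one_equivalent (dist_fun H) (dist_fun G) \<and> btt_reducible 1 (Some \<circ> f) (dist_fun H)"
    if "computable_graph H" "graph_isomorphic H G" for H
  proof -
    obtain k where k: "bij k" "computable k" "computable (inv k)"
      "dist_fun H = Some \<circ> (\<lambda>z. D (node_of (inv k (fst (prod_decode z))))
        (node_of (inv k (snd (prod_decode z)))))"
      using \<open>computable_graph H\<close> \<open>graph_isomorphic H G\<close> by (rule computable_copyE)
    have "turing_degree (dist_fun H) = turing_degree (Some \<circ> f)"
      unfolding k(4) by (rule turing_degree_eq[OF copy_turing_equivalent[OF k(1-3) HOL.refl]])
    moreover have "btt_reducible 1 (Some \<circ> f) (dist_fun H)"
      unfolding k(4) by (rule btt_reducible_copy[OF k(1-3) HOL.refl])
    moreover have "one_equivalent (dist_fun H) (dist_fun G)"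
      unfolding one_equivalent_def
      using one_reducible_copies[OF k(1,3) l(1,2) k(4) l(4)]
        one_reducible_copies[OF l(1,3) k(1,2) l(4) k(4)] by blast
    ultimately show ?thesis by blast
  qed
  have "btt_reducible 2 (dist_fun G) (Some \<circ> f)"
    unfolding l(4) by (rule copy_btt_reducible[OF l(1-3) HOL.refl])
  moreover have "connected_graph G"
  proof -
    \<comment> \<open>Connectedness is read off from the totality of the distance function.\<close>
    have "\<exists>xs. path_between G x y xs" for x y
    proof (rule ccontr)
      assume "\<not> ?thesis"
      then have "dist_fun G (prod_encode (x, y)) = None" by (simp add: dist_fun_def)
      then show False unfolding l(4) by simp
    qed
    then show ?thesis unfolding connected_graph_def by blast
  qed
  moreover have "dist_spectrum G = {turing_degree (Some \<circ> f)}"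
    using copy computable_graph_G iso unfolding dist_spectrum_def by blast
  ultimately show ?thesis
    using copy computable_graph_G by blast
qed

end
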